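(* A triangle-free graph $G$ of order $10$ is $(3,1)$-critical if and only if it is isomorphic to $G_5$.
   Context: Graphs are finite, undirected, with no loops or multiple edges. The order of a graph is its number of vertices. $\Delta(G)$ is the maximum degree and $G[U]$ is the subgraph induced on $U$. For a nonnegative integer $k$, a set $U\subseteq V(G)$ is $k$-independent if $\Delta(G[U])\le k$. $G$ is $(m,k)$-colourable if $V(G)$ can be partitioned into $m$ (possibly empty) $k$-independent sets. The $k$-defective chromatic number $\chi_k(G)$ is the least positive integer $m$ for which $G$ is $(m,k)$-colourable. A graph $G$ is $(m,k)$-critical if $\chi_k(G)=m$ and $\chi_k(G-u)<m$ for every vertex $u\in V(G)$. $G_5$ is the graph with the 10 vertices $u,v,u_1,u_2,u_3,u_4,u_5,z_1,z_2,z$ and exactly the following edges: each of $u,v$ is adjacent to each of $u_1,u_2,u_3,u_4,u_5$; $z$ is adjacent to $u_1,u_2,z_1,z_2$; $z_1$ is adjacent to $u_3,u_4$; $z_2$ is adjacent to $u_3,u_5$. *)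

theory Defs
  imports "Graph_Theory.Graph_Theory" "HOL-Library.Disjoint_Sets"
begin

text \<open>Finite simple graphs are the structures satisfying \<^locale>\<open>graph\<close>: finite symmetric digraphs
  without loops or parallel arcs, each undirected edge \<open>xy\<close> being the pair of arcs from \<open>x\<close> to \<open>y\<close>
  and from \<open>y\<close> to \<open>x\<close>. In particular, the degree of a vertex is its out-degree.\<close>

definition triangle_free :: "('a, 'b) pre_digraph \<Rightarrow> bool" where
  "triangle_free G \<longleftrightarrow> \<not> (\<exists>x y z. x \<rightarrow>\<^bsub>G\<^esub> y \<and> y \<rightarrow>\<^bsub>G\<^esub> z \<and> z \<rightarrow>\<^bsub>G\<^esub> x)"

text \<open>Inserting \<open>0\<close> makes the maximum degree of the graph without vertices \<open>0\<close>, so that the empty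
  set is \<open>k\<close>-independent; it has no effect on nonempty graphs.\<close>

definition max_degree :: "('a, 'b) pre_digraph \<Rightarrow> nat" where
  "max_degree G = Max (insert 0 (out_degree G ` verts G))"

definition k_independent :: "('a, 'b) pre_digraph \<Rightarrow> nat \<Rightarrow> 'a set \<Rightarrow> bool" where
  "k_independent G k U \<longleftrightarrow> U \<subseteq> verts G \<and> max_degree (G \<restriction> U) \<le> k"

definition defective_colourable :: "('a, 'b) pre_digraph \<Rightarrow> nat \<Rightarrow> nat \<Rightarrow> bool" where
  "defective_colourable G m k \<longleftrightarrow>
    (\<exists>P :: nat \<Rightarrow> 'a set. disjoint_family_on P {..<m} \<and> (\<Union>i<m. P i) = verts G \<and>
       (\<forall>i<m. k_independent G k (P i)))"

definition defective_chromatic_number :: "nat \<Rightarrow> ('a, 'b) pre_digraph \<Rightarrow> nat" where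
  "defective_chromatic_number k G = (LEAST m. 0 < m \<and> defective_colourable G m k)"

definition defective_critical :: "('a, 'b) pre_digraph \<Rightarrow> nat \<Rightarrow> nat \<Rightarrow> bool" where
  "defective_critical G m k \<longleftrightarrow>
    defective_chromatic_number k G = m \<and>
    (\<forall>u \<in> verts G. defective_chromatic_number k (pre_digraph.del_vert G u) < m)"

datatype g5_vertex =
  g5_u | g5_v | g5_u1 | g5_u2 | g5_u3 | g5_u4 | g5_u5 | g5_z1 | g5_z2 | g5_z

definition G5 :: "(g5_vertex, g5_vertex \<times> g5_vertex) pre_digraph" where
  "G5 =
    (let E = {g5_u, g5_v} \<times> {g5_u1, g5_u2, g5_u3, g5_u4, g5_u5} \<union>
             {g5_z} \<times> {g5_u1, g5_u2, g5_z1, g5_z2} \<union>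
             {g5_z1} \<times> {g5_u3, g5_u4} \<union>
             {g5_z2} \<times> {g5_u3, g5_u5}
     in \<lparr> verts = UNIV, arcs = E \<union> E\<inverse>, tail = fst, head = snd \<rparr>)"

end

theory Submission
  imports Defs
begin

text \<open>A triangle-free graph of order 10 that is not \<open>(2,1)\<close>-colourable contains one of three
  graphs: \<open>G\<^sub>5\<close>, or one of two graphs \<open>H\<^sub>1\<close>, \<open>H\<^sub>2\<close> of order 9 that are themselves not
  \<open>(2,1)\<close>-colourable. To see this, grow a subgraph \<open>E\<close> of \<open>G\<close> from the empty graph: every
  2-colouring of the vertices has a monochromatic path with two edges in \<open>G\<close>, so for a fixed
  2-colouring, proper for \<open>E\<close>, one of the few paths that create no triangle with \<open>E\<close> can be added.
  Up to relabelling, 97 partial graphs suffice; they and the 2-colourings were found by a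
  computer search. A critical \<open>G\<close> contains neither \<open>H\<^sub>1\<close> nor \<open>H\<^sub>2\<close>, since deleting the
  tenth vertex would leave a graph that is not \<open>(2,1)\<close>-colourable. So it contains \<open>G\<^sub>5\<close>, and it has
  no further edge because any edge added to \<open>G\<^sub>5\<close> creates a triangle or a copy of \<open>H\<^sub>2\<close>.\<close>

section \<open>Defective colourings as maps\<close>

text \<open>The condition on \<open>x\<close>, \<open>y\<close>, \<open>z\<close> forbids
  monochromatic paths with two edges, which is what defect 1 means for a simple graph. The set
  \<open>W\<close> allows vertices to be deleted without changing the type.\<close>

definition colourable1 :: "('v \<Rightarrow> 'v \<Rightarrow> bool) \<Rightarrow> 'v set \<Rightarrow> nat \<Rightarrow> bool" where
  "colourable1 R W m \<longleftrightarrow> (\<exists>c :: 'v \<Rightarrow> nat. (\<forall>x\<in>W. c x < m) \<and>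
     (\<forall>x\<in>W. \<forall>y\<in>W. \<forall>z\<in>W. R y x \<longrightarrow> R y z \<longrightarrow> c x = c y \<longrightarrow> c z = c y \<longrightarrow> x = z))"

text \<open>Without parallel arcs, \<open>head G\<close> is injective on the arcs leaving
  \<open>x\<close>, so these arcs can be counted by their heads.\<close>

lemma (in digraph) out_degree_induce:
  assumes "x \<in> U"
  shows "out_degree (G \<restriction> U) x = card {y \<in> U. x \<rightarrow>\<^bsub>G\<^esub> y}"
proof -
  have "inj_on (head G) (out_arcs (G \<restriction> U) x)"
    by (rule inj_onI) (auto simp: arc_to_ends_def intro: no_multi_arcs)
  moreover have "head G ` out_arcs (G \<restriction> U) x = {y \<in> U. x \<rightarrow>\<^bsub>G\<^esub> y}"
    using assms by (auto simp: arcs_ends_conv)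
  ultimately show ?thesis
    unfolding out_degree_def by (metis card_image)
qed

text \<open>A finite set has at most one element iff any two of its elements agree; this replaces
  degrees by a first-order condition.\<close>

lemma (in digraph) k_independent_1_iff:
  "k_independent G 1 U \<longleftrightarrow> U \<subseteq> verts G \<and>
     (\<forall>x\<in>U. \<forall>y\<in>U. \<forall>z\<in>U. y \<rightarrow>\<^bsub>G\<^esub> x \<longrightarrow> y \<rightarrow>\<^bsub>G\<^esub> z \<longrightarrow> x = z)"
proof (cases "U \<subseteq> verts G")
  case True
  then have fin: "finite U" using finite_verts finite_subset by blast
  have "max_degree (G \<restriction> U) \<le> 1 \<longleftrightarrow> (\<forall>y\<in>U. card {x \<in> U. y \<rightarrow>\<^bsub>G\<^esub> x} \<le> Suc 0)"
    unfolding max_degree_def using fin by (auto simp: out_degree_induce)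
  also have "\<dots> \<longleftrightarrow> (\<forall>y\<in>U. \<forall>x\<in>U. \<forall>z\<in>U. y \<rightarrow>\<^bsub>G\<^esub> x \<longrightarrow> y \<rightarrow>\<^bsub>G\<^esub> z \<longrightarrow> x = z)"
    using fin by (subst card_le_Suc0_iff_eq) auto
  finally show ?thesis using True unfolding k_independent_def by blast
qed (simp add: k_independent_def)

text \<open>The classes are the fibres of a colouring, carried over along the labelling
  \<open>f\<close>. This moves the problem from an arbitrary vertex type to relations on a fixed
  type, and \<open>W\<close> covers vertex deletions.\<close>

lemma (in digraph) defective_colourable_1_iff:
  assumes f: "inj_on f W" "verts G = f ` W"
    and R: "\<And>x y. x \<in> W \<Longrightarrow> y \<in> W \<Longrightarrow> f x \<rightarrow>\<^bsub>G\<^esub> f y \<longleftrightarrow> R x y"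
  shows "defective_colourable G m 1 \<longleftrightarrow> colourable1 R W m"
proof
  assume "defective_colourable G m 1"
  then obtain P where P: "(\<Union>i<m. P i) = verts G" "\<And>i. i < m \<Longrightarrow> k_independent G 1 (P i)"
    unfolding defective_colourable_def by blast
  have "\<forall>x\<in>W. \<exists>i<m. f x \<in> P i" using P(1) f(2) by blast
  then obtain c where c: "\<And>x. x \<in> W \<Longrightarrow> c x < m" "\<And>x. x \<in> W \<Longrightarrow> f x \<in> P (c x)"
    by metis
  have "x = z" if "x \<in> W" "y \<in> W" "z \<in> W" "R y x" "R y z" "c x = c y" "c z = c y" for x y z
  proof -
    have "f x = f z"
      using P(2)[OF c(1)[OF that(2)]] c(2)[OF that(1)] c(2)[OF that(2)] c(2)[OF that(3)] that R
      unfolding k_independent_1_iff by metis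
    then show ?thesis using f(1) that by (meson inj_onD)
  qed
  then show "colourable1 R W m" unfolding colourable1_def using c(1) by blast
next
  assume "colourable1 R W m"
  then obtain c :: "_ \<Rightarrow> nat" where c: "\<And>x. x \<in> W \<Longrightarrow> c x < m"
    "\<And>x y z. \<lbrakk>x \<in> W; y \<in> W; z \<in> W; R y x; R y z; c x = c y; c z = c y\<rbrakk> \<Longrightarrow> x = z"
    unfolding colourable1_def by blast
  define P where "P i = f ` {x \<in> W. c x = i}" for i
  have "disjoint_family_on P {..<m}"
    unfolding disjoint_family_on_def P_def using f(1) by (auto dest: inj_onD)
  moreover have "(\<Union>i<m. P i) = verts G"
    unfolding P_def using c(1) f(2) by auto
  moreover have "k_independent G 1 (P i)" for i
    unfolding k_independent_1_iff
  proof (intro conjI ballI impI)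
    show "P i \<subseteq> verts G" unfolding P_def f(2) by blast
    fix x y z assume "x \<in> P i" "y \<in> P i" "z \<in> P i" "y \<rightarrow>\<^bsub>G\<^esub> x" "y \<rightarrow>\<^bsub>G\<^esub> z"
    then show "x = z" unfolding P_def using R c(2) by (smt (verit) image_iff mem_Collect_eq)
  qed
  ultimately show "defective_colourable G m 1" unfolding defective_colourable_def by blast
qed

lemma colourable1_mono:
  assumes "colourable1 R W m" "m \<le> n"
  shows "colourable1 R W n"
proof -
  from assms(1) obtain c :: "'a \<Rightarrow> nat" where "\<forall>x\<in>W. c x < m"
    "\<forall>x\<in>W. \<forall>y\<in>W. \<forall>z\<in>W. R y x \<longrightarrow> R y z \<longrightarrow> c x = c y \<longrightarrow> c z = c y \<longrightarrow> x = z"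
    unfolding colourable1_def by blast
  with assms(2) show ?thesis unfolding colourable1_def by (intro exI[of _ c]) auto
qed

text \<open>The vertex \<open>u\<close> receives the new colour \<open>m\<close> and forms a class
  of its own.\<close>

lemma colourable1_Suc:
  assumes "colourable1 R (W - {u}) m"
  shows "colourable1 R W (Suc m)"
proof -
  from assms obtain c :: "'a \<Rightarrow> nat" where c: "\<forall>x\<in>W - {u}. c x < m"
    "\<forall>x\<in>W - {u}. \<forall>y\<in>W - {u}. \<forall>z\<in>W - {u}. R y x \<longrightarrow> R y z \<longrightarrow> c x = c y \<longrightarrow> c z = c y \<longrightarrow> x = z"
    unfolding colourable1_def by blast
  let ?c = "c(u := m)"
  have "x = z" if "x \<in> W" "y \<in> W" "z \<in> W" "R y x" "R y z" "?c x = ?c y" "?c z = ?c y" for x y z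
  \<comment> \<open>If the middle vertex is \<open>u\<close>, both ends carry the colour
    \<open>m\<close> too and hence equal \<open>u\<close>; otherwise the common colour is below
    \<open>m\<close> and \<open>u\<close> does not occur.\<close>
  proof (cases "y = u")
    case True
    then have "\<not> ?c x < m" "\<not> ?c z < m" using that by auto
    then have "x = u" "z = u" using c(1) that(1,3) by (auto split: if_splits)
    then show ?thesis by simp
  next
    case False
    then have "?c y < m" using c(1) that(2) by simp
    then have "x \<noteq> u" "z \<noteq> u" using that by auto
    moreover have "c x = c y" "c z = c y" using that False calculation by auto
    ultimately show ?thesis using False c(2) that by blast
  qed
  moreover have "\<forall>x\<in>W. ?c x < Suc m" using c(1) by (simp add: less_Suc_eq)
  ultimately show ?thesis unfolding colourable1_def by blast
qed

section \<open>Chromatic number and criticality\<close>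

text \<open>The least number is attained because some colouring exists, and colourability is
  monotone in the number of colours.\<close>

lemma (in digraph) defective_chromatic_number_le_iff:
  assumes "0 < m"
  shows "defective_chromatic_number 1 G \<le> m \<longleftrightarrow> defective_colourable G m 1"
proof -
  have iff: "defective_colourable G n 1 \<longleftrightarrow> colourable1 (\<lambda>x y. x \<rightarrow>\<^bsub>G\<^esub> y) (verts G) n" for n
    by (rule defective_colourable_1_iff[where f = id]) auto
  \<comment> \<open>An injective colouring has singleton classes and is therefore admissible;
    \<open>Suc n\<close> stays positive even for the empty graph.\<close>
  obtain g :: "'a \<Rightarrow> nat" and n where "g ` verts G = {i. i < n}" "inj_on g (verts G)"
    using finite_imp_inj_to_nat_seg[OF finite_verts] by blast
  then have "colourable1 (\<lambda>x y. x \<rightarrow>\<^bsub>G\<^esub> y) (verts G) (Suc n)"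
    unfolding colourable1_def by (intro exI[of _ g]) (auto dest: inj_onD intro: less_SucI)
  then have "0 < Suc n \<and> defective_colourable G (Suc n) 1" using iff by simp
  from LeastI[of "\<lambda>m. 0 < m \<and> defective_colourable G m 1", OF this]
  have "defective_colourable G (defective_chromatic_number 1 G) 1"
    unfolding defective_chromatic_number_def by blast
  moreover have "defective_chromatic_number 1 G \<le> m" if "defective_colourable G m 1"
    unfolding defective_chromatic_number_def using that assms by (intro Least_le) simp
  ultimately show ?thesis using iff colourable1_mono by blast
qed

text \<open>Everything reduces to colourings with two colours, since a 2-colouring of any
  vertex-deleted graph extends to a 3-colouring by \<open>colourable1_Suc\<close>.\<close>

lemma defective_critical_3_1_iff:
  assumes "graph G" and f: "bij_betw f UNIV (verts G)"
    and R: "\<And>x y. f x \<rightarrow>\<^bsub>G\<^esub> f y \<longleftrightarrow> R x y"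
  shows "defective_critical G 3 1 \<longleftrightarrow> \<not> colourable1 R UNIV 2 \<and> (\<forall>u. colourable1 R (UNIV - {u}) 2)"
proof -
  interpret graph G by fact
  have inj: "inj f" and verts: "verts G = range f" using f by (auto simp: bij_betw_def)
  have le: "defective_chromatic_number 1 G \<le> m \<longleftrightarrow> colourable1 R UNIV m" if "0 < m" for m
    using defective_chromatic_number_le_iff[OF that] defective_colourable_1_iff[OF inj verts R] by simp
  have del: "defective_chromatic_number 1 (del_vert (f u)) \<le> 2 \<longleftrightarrow> colourable1 R (UNIV - {u}) 2" for u
  proof -
    interpret H: fin_digraph "del_vert (f u)" by (rule fin_digraph_del_vert)
    interpret H: digraph "del_vert (f u)"
      by unfold_locales (auto simp: del_vert_simps arc_to_ends_def no_loops intro: no_multi_arcs)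
    have "defective_colourable (del_vert (f u)) 2 1 \<longleftrightarrow> colourable1 R (UNIV - {u}) 2"
    proof (rule H.defective_colourable_1_iff)
      show "inj_on f (UNIV - {u})" using inj by (rule inj_on_subset) simp
      show "verts (del_vert (f u)) = f ` (UNIV - {u})"
        using inj by (auto simp: del_vert_simps verts inj_eq)
      fix x y assume "x \<in> UNIV - {u}" "y \<in> UNIV - {u}"
      then have "f x \<rightarrow>\<^bsub>del_vert (f u)\<^esub> f y \<longleftrightarrow> f x \<rightarrow>\<^bsub>G\<^esub> f y"
        using inj by (auto simp: arcs_ends_conv del_vert_simps inj_eq image_iff)
      then show "f x \<rightarrow>\<^bsub>del_vert (f u)\<^esub> f y \<longleftrightarrow> R x y" using R by simp
    qed
    then show ?thesis using H.defective_chromatic_number_le_iff by simp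
  qed
  have "defective_chromatic_number 1 G = 3 \<longleftrightarrow> colourable1 R UNIV 3 \<and> \<not> colourable1 R UNIV 2"
    using le[of 3] le[of 2] by auto
  moreover have "(\<forall>u\<in>verts G. defective_chromatic_number 1 (del_vert u) < 3) \<longleftrightarrow>
      (\<forall>u. colourable1 R (UNIV - {u}) 2)"
    using del by (simp add: verts less_Suc_eq_le numeral_3_eq_3 numeral_2_eq_2)
  moreover have "colourable1 R UNIV 3" if "colourable1 R (UNIV - {u}) 2" for u
    using colourable1_Suc[OF that] by (simp add: numeral_3_eq_3 numeral_2_eq_2)
  ultimately show ?thesis unfolding defective_critical_def by blast
qed

section \<open>Forced extensions of a partial graph\<close>

text \<open>This order gives the digits 0 to 9 their meaning and fixes the order in which pairs, and
  hence extensions, are listed.\<close>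

definition vertices :: "g5_vertex list" where
  "vertices = [g5_u, g5_v, g5_u1, g5_u2, g5_u3, g5_u4, g5_u5, g5_z1, g5_z2, g5_z]"

lemma vertices_UNIV [simp]: "x \<in> set vertices"
  by (cases x) (simp_all add: vertices_def)

lemma finite_g5_vertex: "finite (UNIV :: g5_vertex set)"
  by (rule finite_subset[of _ "set vertices"]) auto

type_synonym edges = "(g5_vertex \<times> g5_vertex) list"

definition adj :: "edges \<Rightarrow> g5_vertex \<Rightarrow> g5_vertex \<Rightarrow> bool" where
  "adj E x y \<longleftrightarrow> (x, y) \<in> set E \<or> (y, x) \<in> set E"

definition included :: "edges \<Rightarrow> (g5_vertex \<Rightarrow> g5_vertex \<Rightarrow> bool) \<Rightarrow> bool" where
  "included E R \<longleftrightarrow> (\<forall>(x, y) \<in> set E. R x y)"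

text \<open>With \<open>x = y = z\<close> the second condition excludes loops, so these relations
  are exactly the triangle-free simple graphs on the type.\<close>

definition trianglefree :: "('v \<Rightarrow> 'v \<Rightarrow> bool) \<Rightarrow> bool" where
  "trianglefree R \<longleftrightarrow> symp R \<and> (\<forall>x y z. R x y \<longrightarrow> R y z \<longrightarrow> \<not> R z x)"

lemma adj_commute: "adj E x y \<longleftrightarrow> adj E y x"
  by (auto simp: adj_def)

lemma included_adj: "symp R \<Longrightarrow> included E R \<Longrightarrow> adj E x y \<Longrightarrow> R x y"
  by (auto simp: included_def adj_def symp_def)

fun pairs :: "'a list \<Rightarrow> ('a \<times> 'a) list" where
  "pairs [] = []"
| "pairs (x # xs) = map (Pair x) xs @ pairs xs"

lemma pairs_cover:
  "x \<in> set xs \<Longrightarrow> y \<in> set xs \<Longrightarrow> x \<noteq> y \<Longrightarrow>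
    (x, y) \<in> set (pairs xs) \<or> (y, x) \<in> set (pairs xs)"
  by (induction xs) auto

text \<open>A 2-colouring is stored as the list \<open>A\<close> of one class; the other class is
  its complement.\<close>

definition same_class :: "g5_vertex list \<Rightarrow> g5_vertex \<Rightarrow> g5_vertex \<Rightarrow> bool" where
  "same_class A x y \<longleftrightarrow> (x \<in> set A \<longleftrightarrow> y \<in> set A)"

text \<open>Properness in the defective sense: a monochromatic edge is fine, a monochromatic path
  with two edges is not.\<close>

definition proper :: "edges \<Rightarrow> g5_vertex list \<Rightarrow> bool" where
  "proper E A \<longleftrightarrow> list_all (\<lambda>(x, z). same_class A x z \<longrightarrow>
     \<not> list_ex (\<lambda>y. same_class A x y \<and> adj E y x \<and> adj E y z) vertices) (pairs vertices)"

text \<open>These are the candidates for new monochromatic edges; a common neighbour in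
  \<open>E\<close> would close a triangle.\<close>

definition free_pairs :: "edges \<Rightarrow> g5_vertex list \<Rightarrow> edges" where
  "free_pairs E A = filter (\<lambda>(x, y). same_class A x y \<and> \<not> adj E x y \<and>
     \<not> list_ex (\<lambda>z. adj E x z \<and> adj E y z) vertices) (pairs vertices)"

text \<open>A busy pair \<open>e\<close> already forms a monochromatic path with an edge of \<open>E\<close>, so adding \<open>e\<close>
  alone subsumes every longer extension that uses \<open>e\<close>.\<close>

definition busy :: "edges \<Rightarrow> g5_vertex list \<Rightarrow> g5_vertex \<times> g5_vertex \<Rightarrow> bool" where
  "busy E A = (\<lambda>(x, y). list_ex (\<lambda>z. same_class A x z \<and> (adj E x z \<or> adj E y z)) vertices)"

text \<open>Both edges are absent from \<open>E\<close>; the negated conjuncts exclude a triangle formed with an edge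
  of \<open>E\<close> between the ends of the path.\<close>

definition is_path :: "edges \<Rightarrow> (g5_vertex \<times> g5_vertex) \<times> (g5_vertex \<times> g5_vertex) \<Rightarrow> bool" where
  "is_path E = (\<lambda>((a, b), (c, d)). a = c \<and> \<not> adj E b d \<or> a = d \<and> \<not> adj E b c \<or>
     b = c \<and> \<not> adj E a d \<or> b = d \<and> \<not> adj E a c)"

text \<open>If \<open>proper E A\<close>, some listed extension occurs in every triangle-free
  \<open>R\<close> that contains \<open>E\<close> and defeats the colouring; see
  \<open>extensions_cover\<close>. Certificates follow this order.\<close>

definition extensions :: "edges \<Rightarrow> g5_vertex list \<Rightarrow> edges list" where
  "extensions E A = (let P = free_pairs E A in
     map (\<lambda>e. [e]) (filter (busy E A) P) @
     map (\<lambda>(e, e'). [e, e']) (filter (is_path E) (pairs (filter (\<lambda>e. \<not> busy E A e) P))))"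

text \<open>A common neighbour in \<open>E\<close> would give a triangle in \<open>R\<close>. Each
  pair is listed in one orientation only, whence the two forms of \<open>e\<close>.\<close>

lemma free_pairs_cover:
  assumes R: "trianglefree R" "included E R" and "R x y" "same_class A x y" "\<not> adj E x y"
  obtains e where "e \<in> set (free_pairs E A)" "e = (x, y) \<or> e = (y, x)"
proof -
  have "symp R" using R(1) by (simp add: trianglefree_def)
  have "\<not> (adj E x z \<and> adj E y z)" for z
    using included_adj[OF \<open>symp R\<close> R(2)] assms(3) R(1) unfolding trianglefree_def by (metis sympD)
  moreover have "x \<noteq> y" using assms(3) R(1) unfolding trianglefree_def by metis
  then have "(x, y) \<in> set (pairs vertices) \<or> (y, x) \<in> set (pairs vertices)"
    by (intro pairs_cover) simp_all
  ultimately show thesis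
    using that[of "(x, y)"] that[of "(y, x)"] assms(4,5) adj_commute[of E x y]
    by (fastforce simp: free_pairs_def same_class_def list_ex_iff)
qed

text \<open>At most one of the two path edges lies in \<open>E\<close>, by properness. If one does,
  it makes the other busy. If none does, either one of them is busy and suffices alone, or both form
  a listed pair.\<close>

lemma extensions_cover:
  assumes R: "trianglefree R" "included E R" and "proper E A"
    and "R y x" "R y z" "x \<noteq> z" and A: "same_class A x y" "same_class A z y"
  shows "\<exists>es \<in> set (extensions E A). included es R"
proof -
  have "symp R" using R(1) by (simp add: trianglefree_def)
  note sym = sympD[OF this] and incl = included_adj[OF this R(2)]
  let ?P = "free_pairs E A"
  have A': "same_class A y x" "same_class A y z" using A by (auto simp: same_class_def)
  \<comment> \<open>A busy free pair that is an edge of \<open>R\<close> is an extension by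
    itself.\<close>
  have single: ?thesis if "e \<in> set ?P" "busy E A e" "e = (y, w) \<or> e = (w, y)" "R y w" for e w
    using that sym unfolding extensions_def Let_def
    by (intro bexI[of _ "[e]"]) (auto simp: included_def)
  have busyI: "busy E A e"
    if "adj E y v" "same_class A y v" "e = (y, w) \<or> e = (w, y)" "same_class A y w" for e v w
    using that unfolding busy_def by (auto simp: list_ex_iff same_class_def)
  have "\<not> (adj E y x \<and> adj E y z)"
  proof
    assume *: "adj E y x \<and> adj E y z"
    have "(x, z) \<in> set (pairs vertices) \<or> (z, x) \<in> set (pairs vertices)"
      by (intro pairs_cover) (simp_all add: \<open>x \<noteq> z\<close>)
    \<comment> \<open>\<open>proper\<close> examines each pair in one orientation, so its content is
      extracted for every listed \<open>(u, v)\<close> and then used for \<open>(x, z)\<close> or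
      \<open>(z, x)\<close>.\<close>
    moreover have "\<not> (same_class A u v \<and> same_class A u y \<and> adj E y u \<and> adj E y v)"
      if "(u, v) \<in> set (pairs vertices)" for u v
      using \<open>proper E A\<close> that vertices_UNIV[of y]
      unfolding proper_def list_all_iff list_ex_iff by blast
    moreover have "same_class A x z" "same_class A z x" using A by (simp_all add: same_class_def)
    ultimately show False using * A by blast
  qed
  then consider "adj E y x" "\<not> adj E y z" | "adj E y z" "\<not> adj E y x" | "\<not> adj E y x" "\<not> adj E y z"
    by blast
  then show ?thesis
  proof cases
    case 1
    obtain e where e: "e \<in> set ?P" "e = (y, z) \<or> e = (z, y)"
      using free_pairs_cover[OF R \<open>R y z\<close> A'(2) 1(2)] by blast
    show ?thesis using single[OF e(1) busyI[OF 1(1) A'(1) e(2) A'(2)] e(2) \<open>R y z\<close>] .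
  next
    case 2
    obtain e where e: "e \<in> set ?P" "e = (y, x) \<or> e = (x, y)"
      using free_pairs_cover[OF R \<open>R y x\<close> A'(1) 2(2)] by blast
    show ?thesis using single[OF e(1) busyI[OF 2(1) A'(2) e(2) A'(1)] e(2) \<open>R y x\<close>] .
  next
    case 3
    obtain e where e: "e \<in> set ?P" "e = (y, x) \<or> e = (x, y)"
      using free_pairs_cover[OF R \<open>R y x\<close> A'(1) 3(1)] by blast
    obtain e' where e': "e' \<in> set ?P" "e' = (y, z) \<or> e' = (z, y)"
      using free_pairs_cover[OF R \<open>R y z\<close> A'(2) 3(2)] by blast
    show ?thesis
    proof (cases "busy E A e \<or> busy E A e'")
      case True
      then show ?thesis
        using single[OF e(1) _ e(2) \<open>R y x\<close>] single[OF e'(1) _ e'(2) \<open>R y z\<close>] by blast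
    next
      case False
      \<comment> \<open>An edge of \<open>E\<close> between \<open>x\<close> and \<open>z\<close>
        would close a triangle in \<open>R\<close>, so the exclusion in \<open>is_path\<close> does
        not apply. Which order of \<open>e\<close> and \<open>e'\<close> is listed is unknown, so
        both are treated.\<close>
      have "\<not> adj E x z" "\<not> adj E z x"
        using incl R(1) \<open>R y x\<close> \<open>R y z\<close> sym unfolding trianglefree_def by metis+
      then have path: "is_path E (e, e')" "is_path E (e', e)"
        using e(2) e'(2) unfolding is_path_def by auto
      have "e \<noteq> e'" using e(2) e'(2) \<open>x \<noteq> z\<close> by auto
      then have "(e, e') \<in> set (pairs (filter (\<lambda>e. \<not> busy E A e) ?P)) \<or>
          (e', e) \<in> set (pairs (filter (\<lambda>e. \<not> busy E A e) ?P))"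
        using False e(1) e'(1) by (intro pairs_cover) auto
      then have "[e, e'] \<in> set (extensions E A) \<or> [e', e] \<in> set (extensions E A)"
        using path unfolding extensions_def Let_def by force
      moreover have "included [e, e'] R" "included [e', e] R"
        using e(2) e'(2) \<open>R y x\<close> \<open>R y z\<close> sym by (auto simp: included_def)
      ultimately show ?thesis by blast
    qed
  qed
qed

section \<open>Certificates\<close>

definition relabel :: "g5_vertex list \<Rightarrow> g5_vertex \<Rightarrow> g5_vertex" where
  "relabel p x = the (map_of (zip vertices p) x)"

text \<open>Ten distinct vertices form a permutation of the type, so even the isolated vertices of
  \<open>F\<close> are placed. Only edges are preserved: the copy need not be induced.\<close>

definition embeds :: "edges \<Rightarrow> g5_vertex list \<Rightarrow> edges \<Rightarrow> bool" where
  "embeds F p E \<longleftrightarrow> length p = 10 \<and> distinct p \<and>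
     list_all (\<lambda>(x, y). adj E (relabel p x) (relabel p y)) F"

lemma bij_relabel:
  assumes "length p = 10" "distinct p"
  shows "bij (relabel p)"
proof -
  have len: "length vertices = length p" and dist: "distinct vertices"
    using assms(1) by (simp_all add: vertices_def)
  have "inj (relabel p)"
  proof (rule injI)
    fix x y assume eq: "relabel p x = relabel p y"
    obtain i j where "x = vertices ! i" "i < length p" "y = vertices ! j" "j < length p"
      using vertices_UNIV[of x] vertices_UNIV[of y] len by (auto simp: in_set_conv_nth simp del: vertices_UNIV)
    then show "x = y"
      using eq assms(2) by (simp add: relabel_def map_of_zip_nth[OF len dist] nth_eq_iff_index_eq)
  qed
  then show ?thesis using finite_UNIV_inj_surj[OF finite_g5_vertex] by (simp add: bij_def)
qed

lemma embeds_included: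
  assumes "symp R" "included E R" "embeds F p E"
  shows "included F (\<lambda>x y. R (relabel p x) (relabel p y))"
  using assms(3) included_adj[OF assms(1,2)]
  unfolding embeds_def list_all_iff by (auto simp: included_def)

text \<open>Colourings are pulled back along \<open>f\<close> and pushed forward along
  \<open>inv f\<close>.\<close>

lemma colourable1_image:
  assumes "inj f"
  shows "colourable1 (\<lambda>x y. R (f x) (f y)) W m \<longleftrightarrow> colourable1 R (f ` W) m"
proof
  assume "colourable1 R (f ` W) m"
  then obtain c :: "_ \<Rightarrow> nat" where "\<forall>x\<in>f ` W. c x < m" and
    c: "\<forall>x\<in>f ` W. \<forall>y\<in>f ` W. \<forall>z\<in>f ` W. R y x \<longrightarrow> R y z \<longrightarrow> c x = c y \<longrightarrow> c z = c y \<longrightarrow> x = z"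
    unfolding colourable1_def by blast
  then show "colourable1 (\<lambda>x y. R (f x) (f y)) W m"
    unfolding colourable1_def
  proof (intro exI[of _ "c \<circ> f"] conjI ballI impI)
    fix x y z assume "x \<in> W" "y \<in> W" "z \<in> W" "R (f y) (f x)" "R (f y) (f z)"
      "(c \<circ> f) x = (c \<circ> f) y" "(c \<circ> f) z = (c \<circ> f) y"
    then have "f x = f z" using c by (simp only: o_apply ball_simps)
    then show "x = z" using assms by (simp add: inj_eq)
  qed simp
next
  assume "colourable1 (\<lambda>x y. R (f x) (f y)) W m"
  then obtain c :: "_ \<Rightarrow> nat" where "\<forall>x\<in>W. c x < m" and
    c: "\<And>x y z. \<lbrakk>x \<in> W; y \<in> W; z \<in> W; R (f y) (f x); R (f y) (f z); c x = c y; c z = c y\<rbrakk> \<Longrightarrow> x = z"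
    unfolding colourable1_def by blast
  then show "colourable1 R (f ` W) m"
    unfolding colourable1_def
  proof (intro exI[of _ "c \<circ> inv f"] conjI ballI impI)
    fix x y z assume "x \<in> f ` W" "y \<in> f ` W" "z \<in> f ` W" "R y x" "R y z"
      "(c \<circ> inv f) x = (c \<circ> inv f) y" "(c \<circ> inv f) z = (c \<circ> inv f) y"
    moreover from this obtain x' y' z' where "x' \<in> W" "y' \<in> W" "z' \<in> W" "x = f x'" "y = f y'" "z = f z'"
      by blast
    ultimately show "x = z" using c[of x' y' z'] assms by simp
  qed (use assms in auto)
qed

section \<open>Forcing and the verification of the search\<close>

text \<open>Since \<open>R\<close> ranges over all relations, a settled graph also settles its
  relabelled copies. For \<open>E = []\<close> the inclusion is void, and the property becomes the
  claim that the search has to establish.\<close>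

definition forces :: "edges set \<Rightarrow> edges \<Rightarrow> bool" where
  "forces \<H> E \<longleftrightarrow> (\<forall>R. trianglefree R \<longrightarrow> \<not> colourable1 R UNIV 2 \<longrightarrow> included E R \<longrightarrow>
     (\<exists>f. bij f \<and> (\<exists>H\<in>\<H>. included H (\<lambda>x y. R (f x) (f y)))))"

text \<open>One pair is consumed per extension; the last clause rejects lists of different
  lengths.\<close>

fun certified :: "edges list \<Rightarrow> edges \<Rightarrow> edges list \<Rightarrow> (nat \<times> g5_vertex list) list \<Rightarrow> bool" where
  "certified Fs E [] [] \<longleftrightarrow> True"
| "certified Fs E (es # ess) ((i, p) # ips) \<longleftrightarrow>
     i < length Fs \<and> embeds (Fs ! i) p (es @ E) \<and> certified Fs E ess ips"
| "certified Fs E _ _ \<longleftrightarrow> False"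

lemma certifiedD:
  "certified Fs E ess ips \<Longrightarrow> es \<in> set ess \<Longrightarrow> \<exists>F\<in>set Fs. \<exists>p. embeds F p (es @ E)"
  by (induction Fs E ess ips rule: certified.induct) auto

text \<open>Since \<open>R\<close> is not 2-colourable, the colouring with class \<open>A\<close>
  fails, so \<open>R\<close> contains \<open>es @ E\<close> for some extension \<open>es\<close>. By
  the certificate this contains a copy of a graph \<open>F\<close> that is already settled, and
  \<open>forces \<H> F\<close> is applied to \<open>R\<close> read through the relabelling.\<close>

lemma forces_step:
  assumes Fs: "\<forall>F\<in>set Fs. forces \<H> F"
    and "proper E A" and cert: "certified Fs E (extensions E A) ips"
  shows "forces \<H> E"
  unfolding forces_def
proof (intro allI impI)
  fix R assume R: "trianglefree R" "\<not> colourable1 R UNIV 2" "included E R"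
  define c :: "g5_vertex \<Rightarrow> nat" where "c x = (if x \<in> set A then 0 else 1)" for x
  have "symp R" using R(1) by (simp add: trianglefree_def)
  have "\<forall>x. c x < 2" by (simp add: c_def)
  then obtain x y z where xyz: "R y x" "R y z" "c x = c y" "c z = c y" "x \<noteq> z"
    using R(2) unfolding colourable1_def by blast
  have "same_class A u v" if "c u = c v" for u v
    using that unfolding same_class_def c_def by (metis zero_neq_one)
  note this[OF xyz(3)] this[OF xyz(4)]
  from extensions_cover[OF R(1,3) \<open>proper E A\<close> xyz(1,2,5) this] obtain es
    where es: "es \<in> set (extensions E A)" "included es R" by blast
  from certifiedD[OF cert es(1)] obtain F p where F: "F \<in> set Fs" "embeds F p (es @ E)" by blast
  let ?f = "relabel p"
  have "bij ?f" using F(2) by (intro bij_relabel) (auto simp: embeds_def)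
  have "included (es @ E) R" using es(2) R(3) by (auto simp: included_def)
  then have "included F (\<lambda>x y. R (?f x) (?f y))"
    using embeds_included[OF \<open>symp R\<close> _ F(2)] by blast
  moreover have "trianglefree (\<lambda>x y. R (?f x) (?f y))"
    using R(1) unfolding trianglefree_def symp_def by blast
  moreover have "\<not> colourable1 (\<lambda>x y. R (?f x) (?f y)) UNIV 2"
    using R(2) colourable1_image[of ?f R UNIV] \<open>bij ?f\<close> by (simp add: bij_is_inj bij_is_surj)
  moreover have "forces \<H> F" using Fs F(1) by blast
  ultimately obtain g H where "bij g" "H \<in> \<H>" "included H (\<lambda>x y. R (?f (g x)) (?f (g y)))"
    unfolding forces_def by blast
  \<comment> \<open>The copy of \<open>H\<close> lies in the relabelled graph, so its position in
    \<open>R\<close> is given by the composition of both bijections.\<close>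
  then show "\<exists>f. bij f \<and> (\<exists>H\<in>\<H>. included H (\<lambda>x y. R (f x) (f y)))"
    using bij_comp[OF \<open>bij g\<close> \<open>bij ?f\<close>] by (intro exI[of _ "?f \<circ> g"]) auto
qed

text \<open>Graphs, vertex sets and relabellings are written as digit strings: consecutive pairs of
  digits are the edges of a graph, and the \<open>i\<close>-th digit of a relabelling is the image of vertex \<open>i\<close>.\<close>

definition vertex_of :: "char \<Rightarrow> g5_vertex" where
  "vertex_of c = the (map_of (zip ''0123456789'' vertices) c)"

text \<open>Evaluation matches the ten digits directly; on other characters \<open>vertex_of\<close>
  is unspecified.\<close>

lemma vertex_of_code [code]:
  "vertex_of CHR ''0'' = g5_u" "vertex_of CHR ''1'' = g5_v"
  "vertex_of CHR ''2'' = g5_u1" "vertex_of CHR ''3'' = g5_u2"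
  "vertex_of CHR ''4'' = g5_u3" "vertex_of CHR ''5'' = g5_u4"
  "vertex_of CHR ''6'' = g5_u5" "vertex_of CHR ''7'' = g5_z1"
  "vertex_of CHR ''8'' = g5_z2" "vertex_of CHR ''9'' = g5_z"
  by (simp_all add: vertex_of_def vertices_def)

fun edges_of :: "string \<Rightarrow> edges" where
  "edges_of (a # b # s) = (vertex_of a, vertex_of b) # edges_of s"
| "edges_of _ = []"

text \<open>An entry \<open>(e, a, cs)\<close> consists of a partial graph, one class of a 2-colouring, and for each
  extension, in the order of \<^const>\<open>extensions\<close>, a pair \<open>(i, p)\<close> such that graph number \<open>i\<close> of the
  list \<open>Fs\<close> (from 0) embeds into the extended graph by the relabelling \<open>p\<close>.\<close>

fun check :: "edges list \<Rightarrow> (string \<times> string \<times> (nat \<times> string) list) list \<Rightarrow> bool" where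
  "check Fs [] \<longleftrightarrow> [] \<in> set Fs"
| "check Fs ((e, a, cs) # rest) \<longleftrightarrow> (let E = edges_of e; A = map vertex_of a in
     proper E A \<and> certified Fs E (extensions E A) (map (\<lambda>(i, p). (i, map vertex_of p)) cs) \<and>
     check (Fs @ [E]) rest)"

text \<open>The invariant is that every graph in \<open>Fs\<close> forces \<open>\<H>\<close>: a
  verified entry is appended to \<open>Fs\<close> and may be cited by later entries. The final test
  requires the empty graph to be among the graphs reached.\<close>

lemma check_forces:
  assumes "check Fs cases" "\<forall>F\<in>set Fs. forces \<H> F"
  shows "forces \<H> []"
  using assms
proof (induction Fs cases rule: check.induct)
  case (2 Fs e a cs rest)
  from 2(2) have "proper (edges_of e) (map vertex_of a)"
    "certified Fs (edges_of e) (extensions (edges_of e) (map vertex_of a))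
       (map (\<lambda>(i, p). (i, map vertex_of p)) cs)"
    and rest: "check (Fs @ [edges_of e]) rest" by (simp_all add: Let_def)
  then have "forces \<H> (edges_of e)" using forces_step 2(3) by blast
  then show ?case using 2(1)[OF refl refl rest] 2(3) by auto
qed auto

text \<open>Vertex 9 is isolated in \<open>H1\<close> and \<open>H2\<close>.\<close>

definition H1 :: edges where
  "H1 = edges_of ''0506071516172728373847485868''"

definition H2 :: edges where
  "H2 = edges_of ''0405071415172627283637384858''"

text \<open>The edges of \<open>G5\<close> once more, as a list fit for evaluation;
  \<open>dominates_G5\<close> proves the agreement.\<close>

definition G5_edges :: edges where
  "G5_edges = edges_of ''020304050612131415169293979874758486''"

text \<open>Numbers 0, 1, 2 denote \<open>H1\<close>, \<open>H2\<close>, \<open>G5_edges\<close>, so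
  the entries are numbered from 3 on. Each cites only earlier ones, and the last, number 99, is the
  empty graph. Number 3, a star with eight leaves, has no extension at all. Number 10 is the star
  with six leaves and number 72 the star with four, which settles every graph with a vertex of
  degree at least 4.\<close>

definition certificate :: "(string \<times> string \<times> (nat \<times> string) list) list" where
  "certificate = [
    (''0102030405060708'', ''09'', []),
    (''0102030405060748'', ''089'', [
      (3, ''0123456798'')]),
    (''010203050607142438394648495978'', ''0458'', [
      (0, ''3512689047''), (0, ''3712689045'')]),
    (''01020305060714243946484959'', ''049'', [
      (0, ''3512689047''), (5, ''0123456789''), (5, ''0125436789'')]),
    (''010203050607142439484959'', ''0289'', [
      (4, ''0235167849''), (6, ''0123456789''), (6, ''0123457689'')]),
    (''01020305060714244849'', ''048'', [
      (4, ''0235167849''), (7, ''0123456789''), (7, ''0123465789''), (7, ''0123475689''),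
      (7, ''0125463789''), (7, ''0125473689''), (7, ''0126473589'')]),
    (''0102030506074849'', ''089'', [
      (3, ''0123567894''), (8, ''0123456789''), (8, ''0132456789''), (8, ''0152436789''),
      (8, ''0162435789''), (8, ''0172435689''), (8, ''0231456789''), (8, ''0251436789''),
      (8, ''0261435789''), (8, ''0271435689''), (8, ''0351426789''), (8, ''0361425789''),
      (8, ''0371425689''), (8, ''0561423789''), (8, ''0571423689''), (8, ''0671423589'')]),
    (''010203050607'', ''0489'', [
      (3, ''0123456789''), (3, ''0123456798''), (4, ''0123456789''), (4, ''0123456798''),
      (3, ''0123567894''), (4, ''0123856749''), (4, ''0123856794''), (4, ''0123956748''),
      (4, ''0123956784''), (9, ''0123456789''), (9, ''0123856749''), (9, ''0123956748'')]),
    (''01030506071224272834384546497989'', ''0478'', [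
      (0, ''1735629048'')]),
    (''0103050607122428343845464989'', ''0148'', [
      (11, ''0123456789'')]),
    (''01030506071224262834384549586989'', ''0468'', [
      (1, ''1635298047''), (0, ''3516748029'')]),
    (''01030506071224283438454958697989'', ''0468'', [
      (0, ''3516748092''), (13, ''0123457689'')]),
    (''0103050607122428343845495889'', ''0148'', [
      (0, ''3516748029''), (13, ''0123456789''), (13, ''0123457689''), (14, ''0123456789'')]),
    (''010305060712242834384989'', ''0239'', [
      (10, ''0135267948''), (12, ''0123456789''), (12, ''0123457689''), (15, ''0123456789''),
      (12, ''0123467589''), (15, ''0123465789''), (15, ''0123475689''), (12, ''0123856749''),
      (12, ''0123857649''), (12, ''0123867549'')]),
    (''010305060712192425283438464759'', ''0249'', [
      (0, ''1536729048''), (1, ''3615489027''), (1, ''3715489026'')]),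
    (''0103050607121924252834384647'', ''04589'', [
      (17, ''0123456789''), (16, ''0341256798'')]),
    (''01030506071224252834384647'', ''01489'', [
      (10, ''0135267948''), (18, ''0123456789''), (16, ''0123456789'')]),
    (''0103050607121924252834384668'', ''04589'', [
      (0, ''3615748029''), (1, ''3615489027''), (16, ''0341256798'')]),
    (''01030506071224252834384668'', ''01489'', [
      (10, ''0135267948''), (20, ''0123456789''), (0, ''3615748029''), (16, ''0123456789'')]),
    (''0103050607121924252834383946596978'', ''02479'', [
      (1, ''3715489026''), (1, ''3615489027''), (2, ''0915367482'')]),
    (''01030506071224252834383946596978'', ''01489'', [
      (22, ''0123456789'')]),
    (''010305060712242528343839465969'', ''0249'', [
      (21, ''0123456789''), (23, ''0123456789'')]),
    (''0103050607122425283438394669'', ''04589'', [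
      (16, ''2104357869''), (24, ''0123456789'')]),
    (''010305060712192425283438394659'', ''02689'', [
      (19, ''0123456789''), (1, ''3615489027''), (25, ''0123456789'')]),
    (''0103050607121924252834383959'', ''0289'', [
      (26, ''0123456789''), (26, ''0123457689'')]),
    (''0103050607121924252834383969'', ''04589'', [
      (19, ''2431085697''), (16, ''2431057896''), (27, ''0123456789'')]),
    (''0103050607122425283438396979'', ''01489'', [
      (28, ''0123456789''), (16, ''2436015897''), (16, ''2437015896'')]),
    (''010305060712242528343839'', ''023'', [
      (27, ''0123456789''), (28, ''0123456789''), (28, ''0123457689''), (19, ''0123456789''),
      (21, ''0123456789''), (25, ''0123456789''), (21, ''0123457689''), (25, ''0123457689''),
      (28, ''0523416789''), (28, ''0523417689''), (25, ''0123856749''), (19, ''0123856749''),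
      (29, ''0123456789''), (25, ''0123857649'')]),
    (''0103050607122425283438'', ''0239'', [
      (10, ''0135267948''), (30, ''0123456789''), (19, ''0123456789''), (21, ''0123456789''),
      (21, ''0123457689''), (19, ''0123856749'')]),
    (''01030506071224283438'', ''0489'', [
      (31, ''0123456789''), (31, ''0123465789''), (31, ''0123475689''), (10, ''0135267948''),
      (10, ''0135267948''), (16, ''0123456789'')]),
    (''0103050607122428344549697989'', ''0239'', [
      (32, ''0125436789'')]),
    (''010305060712242834454989'', ''0148'', [
      (10, ''0135267849''), (32, ''2104367859''), (32, ''0346215798''), (32, ''0347215698''),
      (33, ''0123456789'')]),
    (''01030506071219242834456878'', ''0489'', [
      (32, ''0341256798'')]),
    (''0103050607121924283445'', ''0249'', [
      (32, ''0341256798''), (32, ''0123456789''), (32, ''0123456789''), (32, ''0123456789''),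
      (32, ''0125436789''), (32, ''0125436789''), (35, ''0123456789'')]),
    (''01030506071224283445'', ''01489'', [
      (10, ''0135267849''), (10, ''0135267948''), (36, ''0123456789''), (32, ''2104367859''),
      (34, ''0123456789'')]),
    (''0103050607122428'', ''029'', [
      (10, ''0135267948''), (32, ''0123456789''), (37, ''0123456789''), (37, ''0123465789''),
      (37, ''0123475689''), (37, ''0123856749''), (37, ''0123865749''), (37, ''0123875649''),
      (37, ''0125463789''), (37, ''0125473689''), (32, ''0125436789''), (37, ''0126473589''),
      (32, ''0126435789''), (32, ''0127435689''), (37, ''0125863749''), (37, ''0125873649''),
      (37, ''0126873549'')]),
    (''0103050607122448'', ''0289'', [
      (10, ''0135267849''), (10, ''0135267849''), (10, ''0135267948''), (10, ''0135267948''),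
      (38, ''0123456798''), (38, ''0341256789''), (38, ''0341256789''), (38, ''0341256789''),
      (38, ''0541236789''), (38, ''0541236789''), (38, ''0641235789'')]),
    (''0103050607124849'', ''029'', [
      (38, ''0143856792''), (39, ''0183456792''), (38, ''0341856792''), (39, ''0381456792''),
      (38, ''0541836792''), (38, ''0641835792''), (38, ''0741835692''), (39, ''0581436792''),
      (39, ''0681435792''), (39, ''0781435692''), (10, ''0135267948'')]),
    (''010305060712'', ''02489'', [
      (10, ''0134256789''), (10, ''0134256789''), (10, ''0134256789''), (10, ''0134256789''),
      (10, ''0134256789''), (10, ''0135267849''), (10, ''0135267849''), (10, ''0135267849''),
      (10, ''0135267849''), (10, ''0135267948''), (10, ''0135267948''), (10, ''0135267948''),
      (38, ''0123456789''), (38, ''0123456798''), (39, ''0123456789''), (39, ''0123456798''),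
      (38, ''0123856794''), (39, ''0123856749''), (39, ''0123856794''), (39, ''0123956748''),
      (39, ''0123956784''), (40, ''0123456789''), (40, ''0123856749''), (40, ''0123956748'')]),
    (''0305060712141819'', ''02489'', [
      (10, ''0234156789''), (10, ''0235167849''), (10, ''0235167948''), (10, ''0345167829''),
      (10, ''0345167928''), (10, ''0356178924''), (10, ''1234058967''), (10, ''1234068957''),
      (10, ''1234078956''), (10, ''1245068937''), (10, ''1245078936''), (10, ''1246078935'')]),
    (''03050607121416172325283445486869'', ''0246'', [
      (1, ''3567248019''), (1, ''3567249018''), (1, ''3518094267'')]),
    (''030506071214161723252834454868'', ''02469'', [
      (41, ''0325167948''), (43, ''0123456789''), (1, ''3567248019''), (41, ''2143058967'')]),
    (''030506071214161723252834454879'', ''02469'', [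
      (1, ''3567249018''), (44, ''0123457689''), (41, ''2143058967'')]),
    (''0305060712141617232528344548'', ''02479'', [
      (41, ''0325167948''), (44, ''0123456789''), (45, ''0123456789''), (41, ''2143058967'')]),
    (''0305060712141617232534457879'', ''0247'', [
      (1, ''3567248019''), (1, ''3567249018''), (41, ''3052148967''), (46, ''1032546789''),
      (46, ''1032546798''), (41, ''5032148967'')]),
    (''03050607121416172325344578'', ''02479'', [
      (41, ''0325167948''), (1, ''3567248019''), (47, ''0123456789''), (46, ''0123456798''),
      (46, ''1032546789'')]),
    (''030506071214161723253445'', ''02478'', [
      (41, ''0325167849''), (41, ''1234067958''), (48, ''0123457698''), (48, ''0123456789''),
      (46, ''0123456789''), (46, ''1032546798'')]),
    (''03050607121416172325283439485968'', ''02469'', [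
      (1, ''3518094267''), (1, ''6735189024'')]),
    (''030506071214161723252834394859'', ''02479'', [
      (50, ''0123456789''), (50, ''1032547698'')]),
    (''0305060712141617232528343948'', ''0138'', [
      (41, ''0325167849''), (49, ''0123456789''), (51, ''0123456789''), (1, ''6724098135'')]),
    (''03050607121416172325283448'', ''01389'', [
      (41, ''0325167849''), (41, ''0325167948''), (52, ''0123456789''), (49, ''0123456789''),
      (41, ''1234067958'')]),
    (''0305060712141617232528'', ''0129'', [
      (41, ''1234067958''), (41, ''2143058967''), (49, ''0123456789''), (53, ''0123456789''),
      (53, ''0125436789''), (53, ''0216873549''), (53, ''0217863549''), (49, ''0216873549'')]),
    (''03050607121416172325'', ''01289'', [
      (41, ''1234067859''), (41, ''1234067958''), (54, ''0123456789''), (54, ''0123456798''),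
      (10, ''0356178924''), (41, ''0325167849''), (41, ''0325167948''), (49, ''0123456789'')]),
    (''0305060712142325284849'', ''0249'', [
      (41, ''0324156789''), (41, ''0325167948''), (41, ''2143058967''), (55, ''0123456789''),
      (55, ''2061783549''), (55, ''2071683549''), (55, ''0823456719'')]),
    (''03050607121423254849'', ''01289'', [
      (41, ''0123456789''), (56, ''0123456789''), (56, ''0123456798''), (10, ''0356178924''),
      (41, ''4123058967''), (41, ''4123068957''), (41, ''4123078956''), (41, ''4125068937''),
      (41, ''4125078936''), (41, ''4126078935'')]),
    (''03050607121423252848'', ''0249'', [
      (10, ''0345167928''), (41, ''0324156789''), (41, ''0325167948''), (41, ''0325167948''),
      (55, ''0123456789''), (55, ''2061783549''), (55, ''2071683549''), (41, ''2143058967''),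
      (55, ''0823456719'')]),
    (''03050607121423252889'', ''0249'', [
      (10, ''0345167928''), (41, ''0324156789''), (41, ''0325167948''), (55, ''0123456789''),
      (55, ''2061783549''), (55, ''2071683549''), (55, ''0823956714'')]),
    (''03050607121416192325486889'', ''02469'', [
      (41, ''0324156789''), (41, ''0325167948''), (41, ''1234067958''), (41, ''8304156927''),
      (41, ''8304167925''), (41, ''8415067923'')]),
    (''0305060712141923254889'', ''0249'', [
      (10, ''0345167928''), (41, ''1234067958''), (60, ''0123456789''), (60, ''0123457689''),
      (57, ''0483156729''), (57, ''0483165729''), (57, ''0483175629''), (57, ''0485163729''),
      (57, ''0485173629''), (57, ''0486173529'')]),
    (''03050607121423254889'', ''01289'', [
      (41, ''0123456789''), (41, ''0325167849''), (41, ''0325167948''), (61, ''0123456789''),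
      (58, ''0123456789''), (59, ''0123456798''), (59, ''0143256789''), (59, ''0143265789''),
      (59, ''0143275689''), (59, ''0145263789''), (59, ''0145273689''), (58, ''4306271859'')]),
    (''0305060712142325'', ''02489'', [
      (10, ''0345167829''), (10, ''0345167928''), (41, ''0324156789''), (41, ''0324156789''),
      (10, ''0356178924''), (41, ''0325167849''), (41, ''0325167849''), (41, ''0325167849''),
      (41, ''0325167948''), (41, ''0325167948''), (41, ''0325167948''), (55, ''0123456789''),
      (41, ''2143058967''), (58, ''0123456789''), (59, ''0123456789''), (58, ''0123456798''),
      (59, ''0123456798''), (57, ''0123456789''), (62, ''0123456789''), (62, ''0123456798'')]),
    (''03050607121423282934'', ''0246'', [
      (41, ''2143068957''), (63, ''0143265789''), (63, ''0215873649''), (63, ''2051683947''),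
      (63, ''2051693847''), (63, ''2071583946''), (63, ''2071593846''), (63, ''2058691347''),
      (63, ''0285173649''), (63, ''0295173648''), (63, ''2078591346'')]),
    (''030506071214152328344858'', ''01389'', [
      (41, ''0325167948''), (63, ''3512840967''), (63, ''1032645978''), (41, ''2143067859''),
      (63, ''0123465789''), (63, ''0123475689''), (41, ''4123067859'')]),
    (''03050607121423283448'', ''0249'', [
      (41, ''0325167948''), (41, ''0325167948''), (63, ''0215863749''), (63, ''0215873649''),
      (65, ''0123456789''), (63, ''0216873549''), (65, ''0123465789''), (65, ''0123475689''),
      (64, ''0123456789''), (63, ''0285163749''), (63, ''0285173649''), (63, ''0286173549'')]),
    (''030506071214152328345889'', ''02459'', [
      (41, ''0325167948''), (41, ''1234056789''), (63, ''0215863749''), (63, ''0215873649''),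
      (41, ''8215067934'')]),
    (''03050607121423283489'', ''0249'', [
      (41, ''0325167948''), (63, ''0215863749''), (63, ''0215873649''), (67, ''0123456789''),
      (63, ''0216873549''), (67, ''0123465789''), (67, ''0123475689''), (63, ''0285163749''),
      (63, ''0285173649''), (63, ''0286173549'')]),
    (''0305060712142334'', ''02489'', [
      (10, ''0356178924''), (41, ''0325167849''), (41, ''0325167849''), (41, ''0325167849''),
      (41, ''0325167948''), (41, ''0325167948''), (41, ''0325167948''), (63, ''1032745689''),
      (63, ''1032645789''), (63, ''1032546789''), (64, ''0123456789''), (66, ''0123456789''),
      (68, ''0123456789''), (66, ''0123456798''), (68, ''0123456798''), (64, ''0143256789''),
      (68, ''0143256789''), (68, ''0143256798'')]),
    (''0305060712141889'', ''0248'', [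
      (10, ''0234156789''), (10, ''0235167849''), (10, ''0345167829''), (41, ''1302645879''),
      (41, ''1302546879''), (41, ''1302547869''), (69, ''0813956724''), (41, ''1502346879''),
      (41, ''1502347869''), (69, ''0815936724''), (41, ''1602347859''), (69, ''0816935724''),
      (69, ''0817935624''), (63, ''0893156724''), (63, ''0893165724''), (63, ''0893175624''),
      (63, ''0895163724''), (63, ''0895173624''), (63, ''0896173524'')]),
    (''030506071214'', ''0189'', [
      (10, ''0135267849''), (10, ''0135267948''), (41, ''0123456789''), (41, ''0123456789''),
      (10, ''0356178924''), (41, ''0813256749''), (41, ''0893156724''), (41, ''0913256748''),
      (41, ''0983156724''), (42, ''0123456789''), (70, ''0123456789''), (70, ''0123456798''),
      (63, ''0123456789''), (63, ''0123465789''), (63, ''0123475689''), (69, ''0123456789''),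
      (63, ''0125463789''), (63, ''0125473689''), (69, ''0125436789''), (63, ''0126473589''),
      (69, ''0126435789''), (69, ''0127435689''), (63, ''0143256789''), (63, ''0143265789''),
      (63, ''0143275689''), (63, ''0145263789''), (63, ''0145273689''), (63, ''0146273589'')]),
    (''03050607'', ''3567'', [
      (10, ''0123456789''), (10, ''0134256789''), (10, ''0135267849''), (10, ''0135267948''),
      (41, ''0123456789''), (41, ''0143256789''), (41, ''0183256749''), (41, ''0193256748''),
      (10, ''0234156789''), (10, ''0235167849''), (10, ''0235167948''), (41, ''0213456789''),
      (41, ''0243156789''), (41, ''0283156749''), (41, ''0293156748''), (10, ''0345167829''),
      (10, ''0345167928''), (41, ''0413256789''), (41, ''0423156789''), (41, ''0483156729''),
      (41, ''0493156728''), (10, ''0356178924''), (41, ''0813256749''), (41, ''0823156749''),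
      (41, ''0843156729''), (41, ''0893156724''), (41, ''0913256748''), (41, ''0923156748''),
      (41, ''0943156728''), (41, ''0983156724''), (71, ''0123456789''), (71, ''0123856749''),
      (71, ''0123956748''), (71, ''0213456789''), (71, ''0213856749''), (71, ''0213956748''),
      (71, ''0143856729''), (71, ''0143956728''), (71, ''0413256789''), (71, ''0413856729''),
      (71, ''0413956728''), (71, ''0183956724''), (71, ''0813256749''), (71, ''0813456729''),
      (71, ''0813956724''), (71, ''0913256748''), (71, ''0913456728''), (71, ''0913856724''),
      (71, ''0243856719''), (71, ''0243956718''), (71, ''0423856719''), (71, ''0423956718''),
      (71, ''0283956714''), (71, ''0823456719''), (71, ''0823956714''), (71, ''0923456718''),
      (71, ''0923856714''), (71, ''0483956712''), (71, ''0843956712''), (71, ''0943856712'')]),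
    (''030405121314252667687989'', ''01278'', [
      (72, ''1052634789''), (72, ''1052634879''), (72, ''0123645789''), (72, ''3240516978''),
      (72, ''6012534789''), (72, ''9013247856''), (72, ''9013257846''), (72, ''4230516978''),
      (72, ''9014257836'')]),
    (''03040512131425266768'', ''3456'', [
      (72, ''1052634789''), (72, ''1052634879''), (72, ''1052634978''), (72, ''2031456978''),
      (72, ''0123645789''), (72, ''0123645789''), (72, ''0123645789''), (72, ''0123645879''),
      (72, ''0123645879''), (72, ''0123645978''), (72, ''0123645978''), (72, ''6012534789''),
      (73, ''0123456789'')]),
    (''030405121314262967687989'', ''01569'', [
      (72, ''0123745689''), (72, ''0123645978''), (72, ''1062734589''), (72, ''6012357849''),
      (72, ''9012357846''), (72, ''3240517869''), (72, ''7013246958''), (72, ''8013246957''),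
      (72, ''4230517869'')]),
    (''03040512131467687989'', ''0178'', [
      (72, ''0123645789''), (72, ''0123645789''), (72, ''0123645879''), (72, ''1052634789''),
      (74, ''0123456789''), (74, ''0123459786''), (74, ''1053426789''), (74, ''1053429786''),
      (75, ''0123456789''), (72, ''6012437859''), (72, ''6012347859''), (72, ''6012357849''),
      (72, ''9012437856''), (72, ''9012347856''), (72, ''9012357846''), (72, ''3240516978''),
      (72, ''6013247859''), (72, ''6013257849''), (72, ''9013247856''), (72, ''9013257846''),
      (72, ''4230516978''), (72, ''6014257839''), (72, ''9014257836''), (75, ''1053426789'')]),
    (''0304051213146768'', ''01789'', [
      (72, ''0123645789''), (72, ''0123645789''), (72, ''0123645789''), (72, ''0123645789''),
      (72, ''0123645879''), (72, ''0123645879''), (72, ''0123645879''), (72, ''0123645978''),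
      (72, ''0123645978''), (72, ''0123645978''), (72, ''1052634789''), (72, ''1052634789''),
      (72, ''1052634789''), (72, ''1052634879''), (72, ''1052634879''), (72, ''1052634978''),
      (72, ''1052634978''), (74, ''0123456789''), (74, ''1053426789''), (72, ''6012437859''),
      (72, ''6012347859''), (72, ''6012357849''), (72, ''6013247859''), (72, ''6013257849''),
      (72, ''6014257839''), (76, ''0123456789'')]),
    (''030405121314'', ''2345'', [
      (72, ''0123745689''), (72, ''0123745689''), (72, ''0123745689''), (72, ''0123745689''),
      (72, ''0123745689''), (72, ''0123745689''), (72, ''0123745689''), (72, ''0123645789''),
      (72, ''0123645789''), (72, ''0123645789''), (72, ''0123645789''), (72, ''0123645789''),
      (72, ''0123645789''), (72, ''0123645879''), (72, ''0123645879''), (72, ''0123645879''),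
      (72, ''0123645879''), (72, ''0123645879''), (72, ''0123645978''), (72, ''0123645978''),
      (72, ''0123645978''), (72, ''0123645978''), (72, ''1052734689''), (72, ''1052734689''),
      (72, ''1052734689''), (72, ''1052734689''), (72, ''1052734689''), (72, ''1052734689''),
      (72, ''1052634789''), (72, ''1052634789''), (72, ''1052634789''), (72, ''1052634789''),
      (72, ''1052634789''), (72, ''1052634879''), (72, ''1052634879''), (72, ''1052634879''),
      (72, ''1052634879''), (72, ''1052634978''), (72, ''1052634978''), (72, ''1052634978''),
      (77, ''0123456789''), (77, ''0123456798''), (77, ''0123457689''), (77, ''0123457698''),
      (77, ''0123456897''), (77, ''0123458679''), (77, ''0123458697''), (77, ''0123459678''),
      (77, ''0123459687''), (77, ''0123457896''), (77, ''0123458796''), (77, ''0123459786'')]),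
    (''03040512131625465767'', ''2347'', [
      (72, ''0123645879''), (72, ''0123645978''), (72, ''1042536879''), (72, ''1042536978''),
      (72, ''5130427869''), (72, ''5130427968''), (72, ''6021347859''), (72, ''6021347958'')]),
    (''0304051213164667'', ''01689'', [
      (72, ''1042536879''), (72, ''1042536978''), (72, ''6021347859''), (72, ''6021347958''),
      (72, ''0123645879''), (72, ''0123645879''), (72, ''0123645978''), (78, ''0214536789''),
      (78, ''1402635789''), (78, ''2641750389''), (79, ''0123456789''), (78, ''3641702589''),
      (78, ''1752630489''), (78, ''0763541289'')]),
    (''03040512132527466768'', ''01269'', [
      (72, ''6021347859''), (80, ''0193542768''), (72, ''2031457968''), (72, ''0123645978''),
      (72, ''3240517869''), (78, ''0863541279'')]),
    (''0304051213466768'', ''0169'', [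
      (72, ''0123645978''), (72, ''0123645978''), (72, ''1042536978''), (72, ''6021347859''),
      (72, ''6014278935''), (78, ''0214536789''), (78, ''2684710359''), (78, ''2674810359''),
      (81, ''0123456789''), (81, ''0123456879''), (80, ''6034785219''), (80, ''6034875219''),
      (78, ''2647810359''), (80, ''0723456819''), (80, ''0684537219''), (80, ''0823456719''),
      (80, ''0674538219''), (72, ''3240517869''), (78, ''0763541289''), (78, ''0863541279''),
      (78, ''5647801239'')]),
    (''0304051213174667'', ''01689'', [
      (72, ''0123645879''), (72, ''0123645879''), (72, ''0123645879''), (72, ''0123645879''),
      (72, ''0123645978''), (72, ''0123645978''), (72, ''0123645978''), (72, ''1042537869''),
      (72, ''1042537869''), (72, ''1042537869''), (72, ''1042537968''), (72, ''1042537968''),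
      (78, ''0214536789''), (78, ''1502734689''), (72, ''6014278935''), (82, ''0123456789''),
      (82, ''0123456798'')]),
    (''0304051213174678'', ''01689'', [
      (72, ''0123645879''), (72, ''0123645879''), (72, ''0123645879''), (72, ''0123645978''),
      (72, ''0123645978''), (72, ''0123645978''), (72, ''1042536789''), (72, ''1042536789''),
      (72, ''1042536789''), (72, ''1042537968''), (72, ''1042537968''), (78, ''0214536789''),
      (72, ''4130526789''), (78, ''1502734689''), (72, ''7021345869''), (82, ''0123456897''),
      (82, ''0684351279''), (82, ''0694351278'')]),
    (''0304051213466778'', ''01689'', [
      (72, ''0123645879''), (72, ''0123645879''), (72, ''0123645879''), (72, ''0123645978''),
      (72, ''0123645978''), (72, ''0123645978''), (72, ''1042536879''), (72, ''1042536978''),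
      (72, ''6021347958''), (72, ''1042538967''), (82, ''0674351289''), (82, ''0123456798''),
      (82, ''0674351298''), (78, ''0214536789''), (78, ''4782601359''), (83, ''0215436789''),
      (82, ''0123547689''), (72, ''7012436859''), (72, ''7012356849''), (72, ''7013256849''),
      (82, ''0123456798'')]),
    (''0304051213467879'', ''01678'', [
      (72, ''0123645789''), (72, ''0123645879''), (84, ''0123456789''), (82, ''1798320456''),
      (85, ''0123456789''), (85, ''0123456879''), (78, ''0214536789''), (82, ''2789410356''),
      (72, ''4130526978''), (82, ''2789510346''), (85, ''0123549786''), (84, ''0973456218''),
      (83, ''0974351268''), (83, ''0975341268''), (78, ''0973451268''), (78, ''0973541268''),
      (78, ''0974531268'')]),
    (''030405121346'', ''2345'', [
      (72, ''0123645789''), (72, ''0123645789''), (72, ''0123645789''), (72, ''0123645789''),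
      (72, ''0123645789''), (72, ''0123645789''), (72, ''0123645879''), (72, ''0123645879''),
      (72, ''0123645879''), (72, ''0123645879''), (72, ''0123645879''), (72, ''0123645978''),
      (72, ''0123645978''), (72, ''0123645978''), (72, ''0123645978''), (72, ''1042536789''),
      (72, ''1042536879''), (72, ''1042536978''), (80, ''0123456789''), (80, ''0123456879''),
      (80, ''0123456978''), (72, ''1042537869''), (72, ''1042537968''), (83, ''0123456789''),
      (84, ''0123456789''), (84, ''0123456798''), (72, ''1042538967''), (83, ''0123456879''),
      (84, ''0123456879''), (84, ''0123456897''), (83, ''0123456978''), (84, ''0123456978''),
      (84, ''0123456987''), (78, ''0214536789''), (82, ''0123456789''), (82, ''0123456798''),
      (85, ''0123456789''), (85, ''0123456798''), (82, ''0123456897''), (85, ''0123456879''),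
      (85, ''0123456897''), (85, ''0123456978''), (85, ''0123456987''), (86, ''0123456789''),
      (86, ''0123456879''), (86, ''0123456978'')]),
    (''0305121346474889'', ''01678'', [
      (72, ''0123456789''), (72, ''0123456879''), (78, ''0123654789''), (72, ''0123457869''),
      (78, ''0123754689''), (72, ''8230514967''), (72, ''1042536789''), (72, ''1042536879''),
      (72, ''1042537869''), (72, ''4012367859''), (72, ''4012367859''), (72, ''4012536789''),
      (72, ''4012356789''), (87, ''2301958467''), (72, ''4015267839''), (87, ''5310928467''),
      (87, ''3849015267''), (87, ''9132580467''), (72, ''3250614978''), (72, ''4013256789''),
      (87, ''3849015267''), (72, ''4015267839'')]),
    (''030512134647'', ''01489'', [
      (72, ''0123645879''), (72, ''0123645978''), (72, ''4230516789''), (72, ''4120367859''),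
      (72, ''4120367958''), (72, ''0123458967''), (78, ''0123854679''), (87, ''0123854679''),
      (87, ''0123859467''), (78, ''0123954678''), (87, ''0123954678''), (87, ''0123958467''),
      (72, ''1052634879''), (72, ''1052634978''), (72, ''4021367859''), (72, ''4021367958''),
      (72, ''1042538967''), (87, ''1053824679''), (87, ''1053829467''), (87, ''1053924678''),
      (87, ''1053928467''), (87, ''2301654789''), (87, ''2301754689''), (87, ''5310624789''),
      (87, ''5310724689''), (87, ''2301674589''), (87, ''3476015289''), (87, ''6132457089''),
      (87, ''3467015289''), (87, ''7132456089''), (72, ''3240516789''), (87, ''3476015289''),
      (87, ''3467015289''), (72, ''4016278935''), (88, ''0123456789''), (88, ''0123456798''),
      (87, ''5310674289'')]),
    (''03051213'', ''235'', [
      (72, ''0123745689''), (72, ''0123645789''), (72, ''0123645879''), (72, ''0123645978''),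
      (78, ''0123456789''), (87, ''0123456789''), (87, ''0123457689''), (87, ''0123458679''),
      (87, ''0123459678''), (72, ''0123456789''), (72, ''0123456879''), (72, ''0123456978''),
      (78, ''0123654789''), (87, ''0123654789''), (87, ''0123657489''), (87, ''0123658479''),
      (87, ''0123659478''), (72, ''0123457869''), (72, ''0123457968''), (78, ''0123754689''),
      (87, ''0123754689''), (87, ''0123756489''), (87, ''0123758469''), (87, ''0123759468''),
      (72, ''0123458967''), (78, ''0123854679''), (87, ''0123854679''), (87, ''0123856479''),
      (87, ''0123857469''), (87, ''0123859467''), (78, ''0123954678''), (87, ''0123954678''),
      (87, ''0123956478''), (87, ''0123957468''), (87, ''0123958467''), (72, ''1052734689''),
      (72, ''1052634789''), (72, ''1052634879''), (72, ''1052634978''), (87, ''1053426789''),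
      (87, ''1053427689''), (87, ''1053428679''), (87, ''1053429678''), (72, ''1042536789''),
      (72, ''1042536879''), (72, ''1042536978''), (87, ''1053624789''), (87, ''1053627489''),
      (87, ''1053628479''), (87, ''1053629478''), (72, ''1042537869''), (72, ''1042537968''),
      (87, ''1053724689''), (87, ''1053726489''), (87, ''1053728469''), (87, ''1053729468''),
      (72, ''1042538967''), (87, ''1053824679''), (87, ''1053826479''), (87, ''1053827469''),
      (87, ''1053829467''), (87, ''1053924678''), (87, ''1053926478''), (87, ''1053927468''),
      (87, ''1053928467''), (89, ''0123456789''), (89, ''0123456879''), (89, ''0123456978''),
      (89, ''0123654789''), (89, ''0123654879''), (89, ''0123654978''), (89, ''0123457869''),
      (89, ''0123457968''), (89, ''0123754689''), (89, ''0123754869''), (89, ''0123754968''),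
      (89, ''0123458967''), (89, ''0123854679''), (89, ''0123854769''), (89, ''0123854967''),
      (89, ''0123954678''), (89, ''0123954768''), (89, ''0123954867''), (89, ''0123657849''),
      (89, ''0123657948''), (89, ''0123756849''), (89, ''0123756948''), (89, ''0123658947''),
      (89, ''0123856749''), (89, ''0123856947''), (89, ''0123956748''), (89, ''0123956847''),
      (89, ''0123758946''), (89, ''0123857946''), (89, ''0123957846'')]),
    (''0305061214282967'', ''01489'', [
      (72, ''0241735689''), (72, ''0123745689''), (72, ''2031468957''), (72, ''2031478956''),
      (90, ''0763152489''), (90, ''2481093567''), (90, ''2491083567''), (90, ''0765132489''),
      (72, ''0123456879''), (72, ''2041635879'')]),
    (''030512142829'', ''02679'', [
      (72, ''2340518967''), (90, ''0219435678''), (90, ''0123456789''), (90, ''0125436789''),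
      (72, ''2031468957''), (72, ''2031478956''), (90, ''0413256789''), (90, ''0415236789''),
      (90, ''2481093567''), (90, ''1962043578''), (90, ''1972043568''), (72, ''0123456789''),
      (91, ''0123456789''), (91, ''0123457689''), (90, ''0823154679'')]),
    (''0305121427364756'', ''01379'', [
      (90, ''0271435689''), (90, ''0653172489''), (90, ''0653192478''), (90, ''0123456789''),
      (90, ''0215436789''), (90, ''0623154789''), (90, ''0723154689''), (90, ''3560192478''),
      (90, ''0415236789''), (90, ''0643152789''), (90, ''3580162479''), (90, ''0683152479''),
      (90, ''1742093568''), (90, ''2471083569'')]),
    (''030512143656'', ''01589'', [
      (90, ''0653214789''), (90, ''0653182479''), (90, ''0653192478''), (90, ''0125436789''),
      (90, ''0213456789''), (90, ''0623154789''), (90, ''0413256789''), (90, ''3560172489''),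
      (90, ''0643152789''), (90, ''3580162479''), (90, ''3590162478''), (90, ''0673152489''),
      (72, ''1032548967''), (92, ''0813956724''), (92, ''0913856724''), (93, ''0123456789'')]),
    (''03051214'', ''02489'', [
      (72, ''0162734589''), (72, ''0142635879''), (72, ''0142635978''), (90, ''0142536789''),
      (90, ''0142536789''), (72, ''0123645879''), (72, ''0123645978''), (90, ''0124536789''),
      (90, ''0124536789''), (72, ''0123458967''), (90, ''0218435679''), (90, ''0418235679''),
      (92, ''1802946735''), (90, ''0219435678''), (90, ''0419235678''), (92, ''1902846735''),
      (72, ''1062734589''), (72, ''1052734689''), (72, ''1052634789''), (90, ''0123456789''),
      (90, ''0123456789''), (72, ''1032745689''), (72, ''1032645789''), (90, ''0125436789''),
      (90, ''0125436789''), (72, ''1032546789''), (90, ''0613254789''), (90, ''0615234789''),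
      (92, ''0613758924''), (90, ''0713254689''), (90, ''0715234689''), (92, ''0713658924''),
      (92, ''0123456789''), (94, ''1032548679''), (90, ''1892043567''), (94, ''1032549678''),
      (90, ''1982043567''), (92, ''1032548967''), (94, ''0123456789''), (90, ''0673152489''),
      (94, ''0123457689''), (90, ''0763152489''), (92, ''0143256789''), (90, ''1894023567''),
      (90, ''1984023567''), (92, ''1052348967''), (90, ''0675132489''), (90, ''0765132489'')]),
    (''03051315'', ''02379'', [
      (90, ''0153426789''), (90, ''0153274689''), (90, ''0153294678''), (90, ''0143256789''),
      (90, ''0163254789''), (90, ''0183254679''), (90, ''3510426789''), (90, ''3510274689''),
      (90, ''3510294678''), (90, ''3540216789''), (90, ''3560214789''), (90, ''3580214679''),
      (95, ''0273951468''), (95, ''0723951468''), (95, ''0923751468''), (95, ''0463851279''),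
      (95, ''0643851279''), (95, ''0843651279'')]),
    (''03051323'', ''02458'', [
      (95, ''0314256789''), (95, ''0315284679''), (90, ''0163254789''), (90, ''0173254689''),
      (90, ''0193254678''), (90, ''3520416789''), (72, ''3450712689''), (72, ''3450612789''),
      (72, ''3450612978''), (90, ''3540216789''), (90, ''3580214679''), (90, ''0243156789''),
      (90, ''0243156789''), (90, ''0283154679''), (95, ''0673951248''), (95, ''0763951248''),
      (95, ''0963751248'')]),
    (''0305'', ''06789'', [
      (72, ''0123456789''), (72, ''0123456879''), (72, ''0123456978''), (97, ''6350172489''),
      (97, ''6350182479''), (97, ''6350192478''), (72, ''0123457869''), (72, ''0123457968''),
      (97, ''7350162489''), (97, ''7350182469''), (97, ''7350192468''), (72, ''0123458967''),
      (97, ''8350162479''), (97, ''8350172469''), (97, ''8350192467''), (97, ''9350162478''),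
      (97, ''9350172468''), (97, ''9350182467''), (90, ''0123456789''), (95, ''0123456789''),
      (90, ''0125436789''), (90, ''0213456789''), (95, ''0213456789''), (90, ''0215436789''),
      (90, ''0143256789''), (96, ''0123456789''), (97, ''0123456789''), (97, ''0143256789''),
      (90, ''0145236789''), (95, ''0413256789''), (90, ''0413256789''), (90, ''0415236789''),
      (97, ''0125436789''), (97, ''0145236789''), (90, ''0243156789''), (96, ''0213456789''),
      (97, ''0243156789''), (90, ''0245136789''), (90, ''0423156789''), (90, ''0425136789''),
      (97, ''0245136789''), (96, ''0413256789''), (95, ''0673851249''), (95, ''0673951248''),
      (95, ''0763851249''), (95, ''0763951248''), (95, ''0683951247''), (95, ''0863751249''),
      (95, ''0863951247''), (95, ''0963751248''), (95, ''0963851247''), (95, ''0783951246''),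
      (95, ''0873951246''), (95, ''0973851246'')]),
    ('''', ''03568'', [
      (98, ''0123456789''), (98, ''0123465789''), (98, ''0123485679''), (98, ''3120456789''),
      (98, ''3120465789''), (98, ''3120485679''), (98, ''0125364789''), (98, ''0125384679''),
      (98, ''5120436789''), (98, ''5120364789''), (98, ''5120384679''), (98, ''0126384579''),
      (98, ''6120435789''), (98, ''6120354789''), (98, ''6120384579''), (98, ''8120435679''),
      (98, ''8120354679''), (98, ''8120364579''), (98, ''1032546789''), (98, ''1032475689''),
      (98, ''1032495678''), (98, ''2031546789''), (98, ''2031475689''), (98, ''2031495678''),
      (98, ''1024375689''), (98, ''1024395678''), (98, ''4031526789''), (98, ''4021375689''),
      (98, ''4021395678''), (98, ''1027394568''), (98, ''7031425689''), (98, ''7021345689''),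
      (98, ''7021394568''), (98, ''9031425678''), (98, ''9021345678''), (98, ''9021374568''),
      (98, ''2014375689''), (98, ''2014395678''), (98, ''4012375689''), (98, ''4012395678''),
      (98, ''2017394568''), (98, ''7012345689''), (98, ''7012394568''), (98, ''9012345678''),
      (98, ''9012374568''), (98, ''3015264789''), (98, ''3015284679''), (98, ''5013264789''),
      (98, ''5013284679''), (98, ''3016284579''), (98, ''6013254789''), (98, ''6013284579''),
      (98, ''8013254679''), (98, ''8013264579''), (98, ''4017293568''), (98, ''7014293568''),
      (98, ''9014273568''), (98, ''5016283479''), (98, ''6015283479''), (98, ''8015263479'')])
]"

lemma certificate_correct: "check [H1, H2, G5_edges] certificate"
  by code_simp

text \<open>The three obstructions force themselves through the identity and so may start the
  list.\<close>

lemma forces_empty: "forces {H1, H2, G5_edges} []"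
proof -
  have "forces {H1, H2, G5_edges} F" if "F \<in> set [H1, H2, G5_edges]" for F
    using that unfolding forces_def by (auto intro!: exI[of _ id])
  then show ?thesis using check_forces[OF certificate_correct] by blast
qed

section \<open>The obstructions\<close>

text \<open>Replaces a colouring by finitely many propositional conditions on a Boolean map: no
  vertex \<open>y\<close> shares its value with two of its neighbours in \<open>E\<close>. All ends
  of edges of \<open>E\<close> lie in \<open>W\<close>, so a colouring of \<open>W\<close> yields
  every condition.\<close>

lemma colourable1_2_bool:
  assumes "symp R" "included E R" "colourable1 R W 2" and E: "\<And>x y. adj E x y \<Longrightarrow> x \<in> W"
  obtains b :: "g5_vertex \<Rightarrow> bool" where
    "list_all (\<lambda>y. list_all (\<lambda>(x, z). \<not> (b x = b y \<and> b z = b y))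
      (pairs (filter (adj E y) vertices))) vertices"
proof -
  from assms(3) obtain c :: "_ \<Rightarrow> nat" where c: "\<And>x. x \<in> W \<Longrightarrow> c x < 2"
    "\<And>x y z. \<lbrakk>x \<in> W; y \<in> W; z \<in> W; R y x; R y z; c x = c y; c z = c y\<rbrakk> \<Longrightarrow> x = z"
    unfolding colourable1_def by blast
  \<comment> \<open>Both colours are below 2, so equality of colours is decided by being 0.\<close>
  have eq: "c x = c y" if "x \<in> W" "y \<in> W" "(c x = 0) = (c y = 0)" for x y
    using c(1)[OF that(1)] c(1)[OF that(2)] that(3) by auto
  \<comment> \<open>Pairs taken from a duplicate-free list have distinct members, which contradicts
    the \<open>x = z\<close> enforced by the colouring.\<close>
  have pairsD: "x \<in> set xs \<and> z \<in> set xs \<and> (distinct xs \<longrightarrow> x \<noteq> z)"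
    if "(x, z) \<in> set (pairs xs)" for x z and xs :: "g5_vertex list"
    using that by (induction xs) auto
  have "distinct vertices" by (simp add: vertices_def)
  then have no_path: "\<not> ((c x = 0) = (c y = 0) \<and> (c z = 0) = (c y = 0))"
    if "(x, z) \<in> set (pairs (filter (adj E y) vertices))" for x y z
  proof -
    have *: "adj E y x" "adj E y z" "x \<noteq> z"
      using pairsD[OF that] \<open>distinct vertices\<close> by auto
    then have "x \<in> W" "y \<in> W" "z \<in> W" using E adj_commute by blast+
    then show ?thesis
      using *(3) c(2)[of x y z] eq[of x y] eq[of z y] included_adj[OF assms(1,2) *(1)]
        included_adj[OF assms(1,2) *(2)] by metis
  qed
  have "list_all (\<lambda>(x, z). \<not> ((c x = 0) = (c y = 0) \<and> (c z = 0) = (c y = 0)))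
      (pairs (filter (adj E y) vertices))" for y
    unfolding list_all_iff
  proof
    fix p assume "p \<in> set (pairs (filter (adj E y) vertices))"
    then show "case p of (x, z) \<Rightarrow> \<not> ((c x = 0) = (c y = 0) \<and> (c z = 0) = (c y = 0))"
      using no_path[of "fst p" "snd p" y] by (simp add: case_prod_unfold)
  qed
  then show thesis
    using that[of "\<lambda>x. c x = 0"] unfolding list_all_iff[of _ vertices] by blast
qed

lemmas edges_simps = vertices_def adj_def vertex_of_code

text \<open>No edge of \<open>H1\<close> meets \<open>g5_z\<close>, so deleting that vertex keeps
  all of \<open>H1\<close>; the resulting conditions on nine Boolean values are
  unsatisfiable.\<close>

lemma not_colourable1_H1:
  assumes "symp R" "included H1 R"
  shows "\<not> colourable1 R (UNIV - {g5_z}) 2"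
proof
  assume "colourable1 R (UNIV - {g5_z}) 2"
  moreover have "x \<in> UNIV - {g5_z}" if "adj H1 x y" for x y
    using that by (cases x) (auto simp: H1_def edges_simps)
  ultimately obtain b :: "g5_vertex \<Rightarrow> bool" where
    "list_all (\<lambda>y. list_all (\<lambda>(x, z). \<not> (b x = b y \<and> b z = b y))
      (pairs (filter (adj H1 y) vertices))) vertices"
    using colourable1_2_bool[OF assms] by blast
  then show False
    by (simp add: H1_def edges_simps) argo
qed

text \<open>As for \<open>H1\<close>: the edges of \<open>H2\<close> avoid \<open>g5_z\<close>, and
  its Boolean conditions are contradictory.\<close>

lemma not_colourable1_H2:
  assumes "symp R" "included H2 R"
  shows "\<not> colourable1 R (UNIV - {g5_z}) 2"
proof
  assume "colourable1 R (UNIV - {g5_z}) 2"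
  moreover have "x \<in> UNIV - {g5_z}" if "adj H2 x y" for x y
    using that by (cases x) (auto simp: H2_def edges_simps)
  ultimately obtain b :: "g5_vertex \<Rightarrow> bool" where
    "list_all (\<lambda>y. list_all (\<lambda>(x, z). \<not> (b x = b y \<and> b z = b y))
      (pairs (filter (adj H2 y) vertices))) vertices"
    using colourable1_2_bool[OF assms] by blast
  then show False
    by (simp add: H2_def edges_simps) argo
qed

section \<open>Criticality of \<open>G5\<close>\<close>

lemma symp_adj: "symp (adj E)"
  using adj_commute by (auto simp: symp_def)

lemma not_colourable1_G5: "\<not> colourable1 (adj G5_edges) UNIV 2"
proof
  assume "colourable1 (adj G5_edges) UNIV 2"
  moreover have "included G5_edges (adj G5_edges)"
    by (auto simp: included_def adj_def)
  ultimately obtain b :: "g5_vertex \<Rightarrow> bool" where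
    "list_all (\<lambda>y. list_all (\<lambda>(x, z). \<not> (b x = b y \<and> b z = b y))
      (pairs (filter (adj G5_edges y) vertices))) vertices"
    using colourable1_2_bool[OF symp_adj] by blast
  then show False
    by (simp add: G5_edges_def edges_simps) argo
qed

text \<open>Dropping the edges at \<open>u\<close> isolates \<open>u\<close>, which then lies on no
  path. So a test on all ten vertices, open to evaluation, suffices for the deleted graph.\<close>

lemma colourable1_del:
  assumes "proper (filter (\<lambda>(x, y). x \<noteq> u \<and> y \<noteq> u) E) A"
  shows "colourable1 (adj E) (UNIV - {u}) 2"
proof -
  define c :: "g5_vertex \<Rightarrow> nat" where "c x = (if x \<in> set A then 0 else 1)" for x
  have m: "same_class A x y" if "c x = c y" for x y
    using that unfolding same_class_def c_def by (metis zero_neq_one)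
  let ?E = "filter (\<lambda>(x, y). x \<noteq> u \<and> y \<noteq> u) E"
  have "x = z" if "x \<noteq> u" "y \<noteq> u" "z \<noteq> u" "adj E y x" "adj E y z" "c x = c y" "c z = c y" for x y z
  proof (rule ccontr)
    assume "x \<noteq> z"
    then have "(x, z) \<in> set (pairs vertices) \<or> (z, x) \<in> set (pairs vertices)"
      by (intro pairs_cover) simp_all
    moreover have "adj ?E y x" "adj ?E y z" using that by (auto simp: adj_def)
    moreover have "same_class A x z" "same_class A z x" "same_class A x y" "same_class A z y"
      using that m by simp_all
    ultimately show False
      using assms vertices_UNIV[of y] unfolding proper_def list_all_iff list_ex_iff by blast
  qed
  moreover have "\<forall>x. c x < 2" by (simp add: c_def)
  ultimately show ?thesis unfolding colourable1_def by (intro exI[of _ c]) blast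
qed

lemma colourable1_G5_del: "colourable1 (adj G5_edges) (UNIV - {u}) 2"
proof -
  \<comment> \<open>For each deleted vertex the string lists one class of a 2-colouring of the
    remaining nine.\<close>
  let ?A = "\<lambda>u. map vertex_of (case u of
    g5_u \<Rightarrow> ''23467'' | g5_v \<Rightarrow> ''23467'' | g5_u1 \<Rightarrow> ''0178'' | g5_u2 \<Rightarrow> ''0178'' | g5_u3 \<Rightarrow> ''23567'' |
    g5_u4 \<Rightarrow> ''23467'' | g5_u5 \<Rightarrow> ''23458'' | g5_z1 \<Rightarrow> ''23456'' | g5_z2 \<Rightarrow> ''23456'' | g5_z \<Rightarrow> ''23456'')"
  have "list_all (\<lambda>u. proper (filter (\<lambda>(x, y). x \<noteq> u \<and> y \<noteq> u) G5_edges) (?A u)) vertices"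
    by code_simp
  then have "proper (filter (\<lambda>(x, y). x \<noteq> u \<and> y \<noteq> u) G5_edges) (?A u)"
    unfolding list_all_iff using vertices_UNIV by blast
  then show ?thesis by (rule colourable1_del)
qed

section \<open>Copies of \<open>G5\<close> in a critical graph\<close>

text \<open>In \<open>G5\<close> all but two pairs of distinct non-adjacent vertices have a common
  neighbour, which excludes them as new edges. The two remaining pairs, exchanged by an automorphism
  of \<open>G5\<close>, each complete a copy of \<open>H2\<close>.\<close>

lemma extra_edge_H2:
  assumes "trianglefree R" "included G5_edges R" "R x y" "\<not> adj G5_edges x y"
  obtains p where "bij p" "included H2 (\<lambda>x y. R (p x) (p y))"
proof -
  have "symp R" using assms(1) by (simp add: trianglefree_def)
  note sym = sympD[OF this] and incl = included_adj[OF this assms(2)]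
  have "x \<noteq> y" using assms(1,3) unfolding trianglefree_def by metis
  have no_common: "\<not> (adj G5_edges x z \<and> adj G5_edges y z)" for z
    using assms(1,3) incl unfolding trianglefree_def by (metis sympD)
  have "list_all (\<lambda>(x, y). adj G5_edges x y \<or> list_ex (\<lambda>z. adj G5_edges x z \<and> adj G5_edges y z) vertices \<or>
      (x, y) = (g5_u4, g5_z2) \<or> (x, y) = (g5_u5, g5_z1)) (pairs vertices)"
    by code_simp
  moreover have "(x, y) \<in> set (pairs vertices) \<or> (y, x) \<in> set (pairs vertices)"
    by (intro pairs_cover) (simp_all add: \<open>x \<noteq> y\<close>)
  moreover have "\<not> adj G5_edges y x" using assms(4) adj_commute by blast
  ultimately have "(x, y) \<in> {(g5_u4, g5_z2), (g5_u5, g5_z1)} \<or> (y, x) \<in> {(g5_u4, g5_z2), (g5_u5, g5_z1)}"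
    using assms(4) no_common unfolding list_all_iff list_ex_iff by fastforce
  then consider "R g5_u4 g5_z2" | "R g5_u5 g5_z1" using assms(3) sym by blast
  then obtain e p where "R (fst e) (snd e)" "embeds H2 p (e # G5_edges)"
  proof cases
    case 1
    \<comment> \<open>The digits are the images of the vertices of \<open>H2\<close>; the last one,
      \<open>g5_u5\<close>, is the vertex that the copy leaves free.\<close>
    have "embeds H2 (map vertex_of ''4523781096'') ((g5_u4, g5_z2) # G5_edges)" by code_simp
    then show ?thesis using 1 that[of "(g5_u4, g5_z2)"] by simp
  next
    case 2
    have "embeds H2 (map vertex_of ''4623781095'') ((g5_u5, g5_z1) # G5_edges)" by code_simp
    then show ?thesis using 2 that[of "(g5_u5, g5_z1)"] by simp
  qed
  moreover from this have "included (e # G5_edges) R" using assms(2) by (simp add: included_def case_prod_unfold)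
  ultimately show thesis
    using that[of "relabel p"] embeds_included[OF \<open>symp R\<close>] bij_relabel by (simp add: embeds_def)
qed

lemma trianglefree_comp: "trianglefree R \<Longrightarrow> trianglefree (\<lambda>x y. R (f x) (f y))"
  unfolding trianglefree_def symp_def by blast

lemma critical_relabel_G5:
  fixes R :: "g5_vertex \<Rightarrow> g5_vertex \<Rightarrow> bool"
  assumes R: "trianglefree R" "\<not> colourable1 R UNIV 2" and del: "\<And>u. colourable1 R (UNIV - {u}) 2"
  obtains f where "bij f" "\<And>x y. R (f x) (f y) \<longleftrightarrow> adj G5_edges x y"
proof -
  have no_H: "\<not> included H (\<lambda>x y. R (f x) (f y))" if "bij f" "H = H1 \<or> H = H2" for f H
  proof
    assume "included H (\<lambda>x y. R (f x) (f y))"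
    moreover have "symp (\<lambda>x y. R (f x) (f y))" using trianglefree_comp[OF R(1), of f] by (simp add: trianglefree_def)
    ultimately have "\<not> colourable1 (\<lambda>x y. R (f x) (f y)) (UNIV - {g5_z}) 2"
      using that(2) not_colourable1_H1 not_colourable1_H2 by blast
    \<comment> \<open>The isolated vertex 9 of the obstruction sits at \<open>f g5_z\<close>;
      deleting it leaves the copy intact, against \<open>del\<close>.\<close>
    moreover have "f ` (UNIV - {g5_z}) = UNIV - {f g5_z}"
      using that(1) by (simp add: bij_is_inj bij_is_surj image_set_diff)
    ultimately show False
      using del colourable1_image[OF bij_is_inj[OF that(1)], of R] by metis
  qed
  have "included [] R" by (simp add: included_def)
  then obtain f where f: "bij f" "included G5_edges (\<lambda>x y. R (f x) (f y))"
    using forces_empty R no_H unfolding forces_def by blast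
  have "R (f x) (f y) \<longleftrightarrow> adj G5_edges x y" for x y
  proof
    show "R (f x) (f y)" if "adj G5_edges x y"
      using included_adj[OF _ f(2) that] trianglefree_comp[OF R(1), of f] by (simp add: trianglefree_def)
    show "adj G5_edges x y" if "R (f x) (f y)"
    proof (rule ccontr)
      assume "\<not> adj G5_edges x y"
      from extra_edge_H2[OF trianglefree_comp[OF R(1)] f(2) that this]
      obtain p where "bij p" "included H2 (\<lambda>x y. R (f (p x)) (f (p y)))" by blast
      then show False using no_H[OF bij_comp[OF \<open>bij p\<close> f(1)], of H2] by simp
    qed
  qed
  then show thesis using that f(1) by blast
qed

section \<open>Isomorphisms as adjacency-preserving bijections\<close>

lemma dominates_G5: "x \<rightarrow>\<^bsub>G5\<^esub> y \<longleftrightarrow> adj G5_edges x y"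
  by (cases x; cases y; 
      simp add: arcs_ends_conv G5_def G5_edges_def adj_def vertex_of_code image_iff)

text \<open>An isomorphism of digraphs also maps arcs and supplies new end functions. Without
  parallel arcs a bijection of vertices that respects adjacency is enough. Here it runs from the
  labels to \<open>G\<close>, inverse to the vertex map of the isomorphism.\<close>

lemma digraph_iso_G5_iff:
  assumes "graph G"
  shows "digraph_iso G G5 \<longleftrightarrow>
    (\<exists>f. bij_betw f UNIV (verts G) \<and> (\<forall>x y. f x \<rightarrow>\<^bsub>G\<^esub> f y \<longleftrightarrow> x \<rightarrow>\<^bsub>G5\<^esub> y))"
proof -
  interpret graph G by fact
  \<comment> \<open>The arcs of \<open>G5\<close> are themselves the pairs of their ends.\<close>
  have arcs_G5: "arcs G5 = arcs_ends G5" and G5: "verts G5 = UNIV" "tail G5 = fst" "head G5 = snd"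
    by (auto simp: arcs_ends_conv G5_def)
  show ?thesis
  proof
    assume "digraph_iso G G5"
    then obtain h where h: "digraph_isomorphism h" "G5 = app_iso h G"
      unfolding digraph_iso_def by blast
    let ?g = "iso_verts h"
    have inj: "inj_on ?g (verts G)" using h(1) by (simp add: digraph_isomorphism_def)
    have surj: "?g ` verts G = UNIV" using h(2) G5(1) by (metis verts_app_iso)
    have ends: "arcs_ends G5 = (\<lambda>(x, y). (?g x, ?g y)) ` arcs_ends G"
      using h(1) unfolding h(2) arcs_ends_conv digraph_isomorphism_def by (force simp: image_iff)
    have "bij_betw (inv_into (verts G) ?g) UNIV (verts G)"
      using inj surj by (intro bij_betw_inv_into) (simp add: bij_betw_def)
    moreover have "inv_into (verts G) ?g x \<rightarrow>\<^bsub>G\<^esub> inv_into (verts G) ?g y \<longleftrightarrow> x \<rightarrow>\<^bsub>G5\<^esub> y" for x y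
    proof -
      let ?x = "inv_into (verts G) ?g x" and ?y = "inv_into (verts G) ?g y"
      have xy: "?g ?x = x" "?g ?y = y" "?x \<in> verts G" "?y \<in> verts G"
        using surj by (simp_all add: f_inv_into_f inv_into_into)
      \<comment> \<open>An arc of \<open>G5\<close> comes from some arc of \<open>G\<close>;
        injectivity identifies the ends of that arc with the chosen preimages.\<close>
      have uniq: "?x = a \<and> ?y = b" if "a \<rightarrow>\<^bsub>G\<^esub> b" "?g a = x" "?g b = y" for a b
        using that inj xy adj_in_verts[OF that(1)] by (metis inj_onD)
      have "?x \<rightarrow>\<^bsub>G\<^esub> ?y" if "x \<rightarrow>\<^bsub>G5\<^esub> y"
      proof -
        from that obtain a b where "a \<rightarrow>\<^bsub>G\<^esub> b" "?g a = x" "?g b = y" unfolding ends by auto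
        with uniq[OF this] show ?thesis by simp
      qed
      moreover have "x \<rightarrow>\<^bsub>G5\<^esub> y" if "?x \<rightarrow>\<^bsub>G\<^esub> ?y"
        using imageI[OF that, of "\<lambda>(x, y). (?g x, ?g y)"] xy unfolding ends by simp
      ultimately show ?thesis by blast
    qed
    ultimately show "\<exists>f. bij_betw f UNIV (verts G) \<and> (\<forall>x y. f x \<rightarrow>\<^bsub>G\<^esub> f y \<longleftrightarrow> x \<rightarrow>\<^bsub>G5\<^esub> y)"
      by blast
  next
    assume "\<exists>f. bij_betw f UNIV (verts G) \<and> (\<forall>x y. f x \<rightarrow>\<^bsub>G\<^esub> f y \<longleftrightarrow> x \<rightarrow>\<^bsub>G5\<^esub> y)"
    then obtain f where f: "bij_betw f UNIV (verts G)" "\<And>x y. f x \<rightarrow>\<^bsub>G\<^esub> f y \<longleftrightarrow> x \<rightarrow>\<^bsub>G5\<^esub> y"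
      by blast
    have inj: "inj f" and verts: "verts G = range f" using f(1) by (auto simp: bij_betw_def)
    let ?g = "inv f"
    \<comment> \<open>As the arcs of \<open>G5\<close> are pairs, an arc of \<open>G\<close> goes to
      the pair of its relabelled ends, with \<open>fst\<close> and \<open>snd\<close> as new end
      functions.\<close>
    let ?h = "\<lparr>iso_verts = ?g, iso_arcs = (\<lambda>e. (?g (tail G e), ?g (head G e))),
      iso_head = snd, iso_tail = fst\<rparr>"
    have g: "f (?g v) = v" if "v \<in> verts G" for v
      using that verts by (auto simp: f_inv_into_f)
    then have inj_g: "inj_on ?g (verts G)" by (metis inj_onI)
    have "inj_on (\<lambda>e. (?g (tail G e), ?g (head G e))) (arcs G)"
    proof (rule inj_onI)
      fix d e assume "d \<in> arcs G" "e \<in> arcs G"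
        "(?g (tail G d), ?g (head G d)) = (?g (tail G e), ?g (head G e))"
      then have "arc_to_ends G d = arc_to_ends G e"
        using inj_g by (auto simp: arc_to_ends_def dest: inj_onD)
      then show "d = e" using \<open>d \<in> arcs G\<close> \<open>e \<in> arcs G\<close> by (intro no_multi_arcs)
    qed
    then have "digraph_isomorphism ?h"
      unfolding digraph_isomorphism_def using inj_g by (simp add: wf_digraph)
    moreover have "(\<lambda>e. (?g (tail G e), ?g (head G e))) ` arcs G = arcs_ends G5"
    proof -
      have "(\<lambda>e. (?g (tail G e), ?g (head G e))) ` arcs G = (\<lambda>(x, y). (?g x, ?g y)) ` arcs_ends G"
        by (force simp: arcs_ends_conv)
      also have "\<dots> = arcs_ends G5"
      proof (intro set_eqI iffI)
        fix p assume "p \<in> (\<lambda>(x, y). (?g x, ?g y)) ` arcs_ends G"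
        then obtain x y where "x \<rightarrow>\<^bsub>G\<^esub> y" "p = (?g x, ?g y)" by auto
        then show "p \<in> arcs_ends G5" using f(2)[of "?g x" "?g y"] g adj_in_verts by metis
      next
        fix p assume "p \<in> arcs_ends G5"
        moreover obtain x y where "p = (x, y)" by fastforce
        ultimately have "f x \<rightarrow>\<^bsub>G\<^esub> f y" "p = (?g (f x), ?g (f y))"
          using f(2) inj by simp_all
        then show "p \<in> (\<lambda>(x, y). (?g x, ?g y)) ` arcs_ends G" by force
      qed
      finally show ?thesis .
    qed
    then have "G5 = app_iso ?h G"
      using inj arcs_G5 G5 by (intro pre_digraph.equality) (auto simp: verts image_image)
    ultimately show "digraph_iso G G5" unfolding digraph_iso_def by blast
  qed
qed

section \<open>Passage to an arbitrary graph of order ten\<close>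

theorem theorem3p3:
  fixes G :: "('a, 'b) pre_digraph"
  assumes "graph G" and "triangle_free G" and "card (verts G) = 10"
  shows "defective_critical G 3 1 \<longleftrightarrow> digraph_iso G G5"
proof
  interpret graph G by fact
  assume critical: "defective_critical G 3 1"
  \<comment> \<open>The type \<open>g5_vertex\<close> serves here as a set of ten labels;
    \<open>f\<close> is an arbitrary labelling of \<open>G\<close>, so far unrelated to the edges of
    \<open>G5\<close>.\<close>
  have "set vertices = UNIV" by auto
  moreover have "card (set vertices) = 10" by (simp add: vertices_def)
  ultimately have "card (UNIV :: g5_vertex set) = card (verts G)" using assms(3) by simp
  then obtain f where f: "bij_betw f (UNIV :: g5_vertex set) (verts G)"
    using finite_same_card_bij[OF finite_g5_vertex finite_verts] by blast
  define R where "R x y \<longleftrightarrow> f x \<rightarrow>\<^bsub>G\<^esub> f y" for x y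
  have "trianglefree R"
    using assms(2) sym_arcs unfolding trianglefree_def R_def triangle_free_def symp_def
    by (meson arcs_ends_symmetric)
  moreover have "\<not> colourable1 R UNIV 2" "\<And>u. colourable1 R (UNIV - {u}) 2"
    using critical defective_critical_3_1_iff[OF assms(1) f, of R] unfolding R_def by blast+
  ultimately obtain g where g: "bij g" "\<And>x y. R (g x) (g y) \<longleftrightarrow> adj G5_edges x y"
    using critical_relabel_G5 by blast
  have "bij_betw (f \<circ> g) UNIV (verts G)" using g(1) f by (rule bij_betw_trans)
  then show "digraph_iso G G5"
    unfolding digraph_iso_G5_iff[OF assms(1)] dominates_G5
    using g(2) by (intro exI[of _ "f \<circ> g"]) (simp add: R_def)
next
  assume "digraph_iso G G5"
  \<comment> \<open>Under the labelling \<open>f\<close> adjacency in \<open>G\<close> becomes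
    \<open>adj G5_edges\<close>, so criticality can be read off the fixed graph.\<close>
  then obtain f where "bij_betw f UNIV (verts G)" "\<And>x y. f x \<rightarrow>\<^bsub>G\<^esub> f y \<longleftrightarrow> adj G5_edges x y"
    unfolding digraph_iso_G5_iff[OF assms(1)] dominates_G5 by blast
  from defective_critical_3_1_iff[OF assms(1) this] show "defective_critical G 3 1"
    using not_colourable1_G5 colourable1_G5_del by blast
qed

end
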